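(* Let $G$ be a finite group and let $(\mathscr L_H)_{H\le G}$ be an admissible family of nonempty sublattices of a finite $G$-lattice $\mathscr L$ (see context). Let $\widetilde x=(x_{(U,t)})_{(U,t)\in\mathcal R(G,M_{\mathscr L})}\in\widetilde\Omega(G,M_{\mathscr L})^\times$. Then $\widetilde x$ is contained in the image of the ring monomorphism $\alpha_G\circ\varphi_G:\Omega(G,M_{\mathscr L})\to\widetilde\Omega(G,M_{\mathscr L})$ if and only if, for each $(U,t)\in\mathcal R(G,M_{\mathscr L})$, the map $\gamma^{\widetilde x}_{(U,t)}:\mathrm{Aut}((G/U)_t)\to\langle-1\rangle$ given by $$\sigma_g\mapsto x_{(U,t)}\,x_{(\langle g\rangle U,\,s_{(g,t)})}\qquad\text{for all }gU\in W_G(U,t)$$ is a group homomorphism, where $s_{(g,t)}=\inf\{s\in\mathscr L_{\langle g\rangle U}\mid s\geq t\}$.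
   Context: Write ${}^gH=gHg^{-1}$. A finite $G$-lattice is a finite lattice $\mathscr L$ with an order-preserving left $G$-action $(g,s)\mapsto{}^gs$. An admissible family consists of nonempty sublattices $\mathscr L_H\subseteq\mathscr L$, $H\leq G$, such that for all $K\le H\leq G$, $g\in G$: (1) $\mathscr L_{{}^gH}=\{{}^gs\mid s\in\mathscr L_H\}$; (2) ${}^hs=s$ for $h\in H$, $s\in\mathscr L_H$; (3) $s\wedge\sup\mathscr L_K\in\mathscr L_K$ for $s\in\mathscr L_H$; (4) $\sup\mathscr L_K\leq\sup\mathscr L_H$. $M_{\mathscr L}$ denotes the resulting functor $H\mapsto\mathscr L_H$ (monoids under $\wedge$), with restriction maps $s\mapsto s\wedge\sup\mathscr L_K$. $\mathcal S(G,M_{\mathscr L})=\{(K,s)\mid K\leq G,\ s\in\mathscr L_K\}$ with $G$-action $g.(K,s)=({}^gK,{}^gs)$; $\mathcal R(G,M_{\mathscr L})$ is a complete set of representatives of the $G$-orbits; $N_G(K,s)$ is the stabilizer of $(K,s)$ and $W_G(K,s)=N_G(K,s)/K$. The lattice Burnside ring $\Omega(G,M_{\mathscr L})$ is the free abelian group with basis $[(G/K)_s]$, $(K,s)\in\mathcal R(G,M_{\mathscr L})$ (with $[(G/{}^gK)_{{}^gs}]=[(G/K)_s]$), and multiplication $[(G/K)_s]\cdot[(G/U)_t]=\sum_{KhU\in K\backslash G/U}[(G/(K\cap{}^hU))_{s\wedge{}^ht\wedge\sup\mathscr L_{K\cap{}^hU}}]$. $\widetilde\Omega(G,M_{\mathscr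 L})=\prod_{(K,s)\in\mathcal R(G,M_{\mathscr L})}\mathbb Z$ (componentwise ring); $\widetilde\Omega(G,M_{\mathscr L})^\times$ is its unit group (all components $\pm1$). For $(U,t)\in\mathcal S(G,M_{\mathscr L})$ set $x_{(U,t)}=x_{(K,s)}$ where $(K,s)\in\mathcal R(G,M_{\mathscr L})$ is in the orbit of $(U,t)$. The ring monomorphism $\alpha_G\circ\varphi_G$ is the additive map $$[(G/K)_s]\mapsto\bigl(|\{gK\in G/K\mid U\leq{}^gK\text{ and }t\leq{}^gs\}|\bigr)_{(U,t)\in\mathcal R(G,M_{\mathscr L})}.$$ $\mathrm{Aut}((G/U)_t)$ is the group of maps $\sigma_g:G/U\to G/U$, $rU\mapsto rgU$, for $gU\in W_G(U,t)$, under composition. $\langle-1\rangle=\{1,-1\}$. *)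

theory Defs
  imports "HOL-Algebra.Algebra"
begin

section \<open>Finite $G$-lattices and admissible families\<close>

text \<open>The finite lattice is the type \<^typ>\<open>'l\<close> itself, so least upper and greatest lower bounds of
  nonempty subsets are \<^const>\<open>Sup_fin\<close> and \<^const>\<open>Inf_fin\<close>.\<close>

locale finite_G_lattice = group_action G "UNIV :: 'l set" act
  for G :: "('g, 'm) monoid_scheme" (structure)
    and act :: "'g \<Rightarrow> 'l::{finite, lattice} \<Rightarrow> 'l" +
  assumes finite_carrier: "finite (carrier G)"
    and act_mono: "g \<in> carrier G \<Longrightarrow> mono (act g)"

definition conj_set :: "('g, 'm) monoid_scheme \<Rightarrow> 'g \<Rightarrow> 'g set \<Rightarrow> 'g set" where
  "conj_set G g H = g <#\<^bsub>G\<^esub> H #>\<^bsub>G\<^esub> inv\<^bsub>G\<^esub> g"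

definition sublattice :: "'l::lattice set \<Rightarrow> bool" where
  "sublattice A \<longleftrightarrow> (\<forall>x\<in>A. \<forall>y\<in>A. inf x y \<in> A \<and> sup x y \<in> A)"

locale admissible_family = finite_G_lattice G act
  for G :: "('g, 'm) monoid_scheme" (structure)
    and act :: "'g \<Rightarrow> 'l::{finite, lattice} \<Rightarrow> 'l" +
  fixes L :: "'g set \<Rightarrow> 'l set"
  assumes L_nonempty: "subgroup H G \<Longrightarrow> L H \<noteq> {}"
    and L_sublattice: "subgroup H G \<Longrightarrow> sublattice (L H)"
    and L_conj: "subgroup H G \<Longrightarrow> g \<in> carrier G \<Longrightarrow> L (conj_set G g H) = act g ` L H"
    and L_fixed: "subgroup H G \<Longrightarrow> h \<in> H \<Longrightarrow> s \<in> L H \<Longrightarrow> act h s = s"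
    and L_restrict: "subgroup H G \<Longrightarrow> subgroup K G \<Longrightarrow> K \<subseteq> H \<Longrightarrow> s \<in> L H \<Longrightarrow>
          inf s (Sup_fin (L K)) \<in> L K"
    and L_Sup_mono: "subgroup H G \<Longrightarrow> subgroup K G \<Longrightarrow> K \<subseteq> H \<Longrightarrow>
          Sup_fin (L K) \<le> Sup_fin (L H)"


section \<open>The $G$-set $\mathcal S(G,M)$ and its orbit representatives\<close>

definition pairs :: "('g, 'm) monoid_scheme \<Rightarrow> ('g set \<Rightarrow> 'l set) \<Rightarrow> ('g set \<times> 'l) set" where
  "pairs G L = {(K, s). subgroup K G \<and> s \<in> L K}"

text \<open>Extensional on \<^const>\<open>pairs\<close>, as \<^const>\<open>BijGroup\<close> and hence \<^const>\<open>group_action\<close> require.\<close>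

definition pair_act ::
  "('g, 'm) monoid_scheme \<Rightarrow> ('g \<Rightarrow> 'l \<Rightarrow> 'l) \<Rightarrow> ('g set \<Rightarrow> 'l set) \<Rightarrow> 'g \<Rightarrow> 'g set \<times> 'l \<Rightarrow> 'g set \<times> 'l"
where
  "pair_act G act L g = (\<lambda>(K, s)\<in>pairs G L. (conj_set G g K, act g s))"

definition orbit_reps ::
  "('g, 'm) monoid_scheme \<Rightarrow> ('g \<Rightarrow> 'l \<Rightarrow> 'l) \<Rightarrow> ('g set \<Rightarrow> 'l set) \<Rightarrow> ('g set \<times> 'l) set \<Rightarrow> bool"
where
  "orbit_reps G act L R \<longleftrightarrow>
     R \<subseteq> pairs G L \<and> (\<forall>p\<in>pairs G L. \<exists>!q. q \<in> R \<and> q \<in> orbit G (pair_act G act L) p)"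

definition rep ::
  "('g, 'm) monoid_scheme \<Rightarrow> ('g \<Rightarrow> 'l \<Rightarrow> 'l) \<Rightarrow> ('g set \<Rightarrow> 'l set) \<Rightarrow> ('g set \<times> 'l) set
    \<Rightarrow> 'g set \<times> 'l \<Rightarrow> 'g set \<times> 'l"
where
  "rep G act L R p = (THE q. q \<in> R \<and> q \<in> orbit G (pair_act G act L) p)"

definition pair_stab ::
  "('g, 'm) monoid_scheme \<Rightarrow> ('g \<Rightarrow> 'l \<Rightarrow> 'l) \<Rightarrow> ('g set \<Rightarrow> 'l set) \<Rightarrow> 'g set \<times> 'l \<Rightarrow> 'g set"
where
  "pair_stab G act L p = stabilizer G (pair_act G act L) p"


section \<open>The lattice Burnside ring\<close>

text \<open>The basis element $[(G/K)_s]$ for an arbitrary pair $(K,s)$.\<close>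

definition basis_elem ::
  "('g, 'm) monoid_scheme \<Rightarrow> ('g \<Rightarrow> 'l \<Rightarrow> 'l) \<Rightarrow> ('g set \<Rightarrow> 'l set) \<Rightarrow> ('g set \<times> 'l) set
    \<Rightarrow> 'g set \<times> 'l \<Rightarrow> ('g set \<times> 'l) \<Rightarrow>\<^sub>0 int"
where
  "basis_elem G act L R p = frag_of (rep G act L R p)"

definition double_cosets ::
  "('g, 'm) monoid_scheme \<Rightarrow> 'g set \<Rightarrow> 'g set \<Rightarrow> 'g set set"
where
  "double_cosets G K U = {K <#>\<^bsub>G\<^esub> (h <#\<^bsub>G\<^esub> U) | h. h \<in> carrier G}"

definition basis_mult ::
  "('g, 'm) monoid_scheme \<Rightarrow> ('g \<Rightarrow> 'l \<Rightarrow> 'l) \<Rightarrow> ('g set \<Rightarrow> 'l::lattice set) \<Rightarrow> ('g set \<times> 'l) set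
    \<Rightarrow> 'g set \<times> 'l \<Rightarrow> 'g set \<times> 'l \<Rightarrow> ('g set \<times> 'l) \<Rightarrow>\<^sub>0 int"
where
  "basis_mult G act L R = (\<lambda>(K, s) (U, t).
     \<Sum>D\<in>double_cosets G K U.
       let h = (SOME h. h \<in> D); I = K \<inter> conj_set G h U
       in basis_elem G act L R (I, inf (inf s (act h t)) (Sup_fin (L I))))"

definition lattice_burnside_ring ::
  "('g, 'm) monoid_scheme \<Rightarrow> ('g \<Rightarrow> 'l \<Rightarrow> 'l) \<Rightarrow> ('g set \<Rightarrow> 'l::lattice set) \<Rightarrow> ('g set \<times> 'l) set
    \<Rightarrow> (('g set \<times> 'l) \<Rightarrow>\<^sub>0 int) ring"
where
  "lattice_burnside_ring G act L R =
     \<lparr>carrier = carrier (free_Abelian_group R),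
      monoid.mult = (\<lambda>x y. frag_extend (\<lambda>p. frag_extend (basis_mult G act L R p) y) x),
      one = basis_elem G act L R (carrier G, Sup_fin (L (carrier G))),
      ring.zero = 0,
      ring.add = (+)\<rparr>"

definition ghost_ring :: "'p set \<Rightarrow> ('p \<Rightarrow> int) ring" where
  "ghost_ring R =
     \<lparr>carrier = R \<rightarrow>\<^sub>E UNIV,
      monoid.mult = (\<lambda>x y. \<lambda>p\<in>R. x p * y p),
      one = (\<lambda>p\<in>R. 1),
      ring.zero = (\<lambda>p\<in>R. 0),
      ring.add = (\<lambda>x y. \<lambda>p\<in>R. x p + y p)\<rparr>"

definition mark ::
  "('g, 'm) monoid_scheme \<Rightarrow> ('g \<Rightarrow> 'l \<Rightarrow> 'l) \<Rightarrow> 'g set \<times> 'l::lattice \<Rightarrow> 'g set \<times> 'l \<Rightarrow> nat"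
where
  "mark G act = (\<lambda>(U, t) (K, s).
     card {g <#\<^bsub>G\<^esub> K | g. g \<in> carrier G \<and> U \<subseteq> conj_set G g K \<and> t \<le> act g s})"

text \<open>The composite $\alpha_G\circ\varphi_G$: the additive extension of
  $[(G/K)_s] \mapsto$ \<open>(mark G act p (K, s))\<^sub>p\<close>.\<close>

definition alpha_phi ::
  "('g, 'm) monoid_scheme \<Rightarrow> ('g \<Rightarrow> 'l \<Rightarrow> 'l) \<Rightarrow> ('g set \<times> 'l::lattice) set
    \<Rightarrow> (('g set \<times> 'l) \<Rightarrow>\<^sub>0 int) \<Rightarrow> ('g set \<times> 'l \<Rightarrow> int)"
where
  "alpha_phi G act R c =
     (\<lambda>p\<in>R. \<Sum>q\<in>Poly_Mapping.keys c. Poly_Mapping.lookup c q * int (mark G act p q))"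


section \<open>Automorphisms of $(G/U)_t$ and the maps $\gamma$\<close>

text \<open>$\sigma_g$ is right multiplication by the coset $gU$: for $g$ normalizing $U$ one has
  $rU \cdot gU = rgU$ (see \<open>sigma_lcoset\<close> below). The index $gU \in W_G(U,t)$ is represented by
  \<open>g\<close> in the stabilizer \<^const>\<open>pair_stab\<close>.\<close>

definition sigma :: "('g, 'm) monoid_scheme \<Rightarrow> 'g set \<Rightarrow> 'g \<Rightarrow> 'g set \<Rightarrow> 'g set" where
  "sigma G U g = (\<lambda>C\<in>lcosets\<^bsub>G\<^esub> U. C <#>\<^bsub>G\<^esub> (g <#\<^bsub>G\<^esub> U))"

definition aut_group ::
  "('g, 'm) monoid_scheme \<Rightarrow> ('g \<Rightarrow> 'l \<Rightarrow> 'l) \<Rightarrow> ('g set \<Rightarrow> 'l set) \<Rightarrow> 'g set \<times> 'l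
    \<Rightarrow> ('g set \<Rightarrow> 'g set) monoid"
where
  "aut_group G act L = (\<lambda>(U, t).
     (BijGroup (lcosets\<^bsub>G\<^esub> U))\<lparr>carrier := sigma G U ` pair_stab G act L (U, t)\<rparr>)"

definition sign_group :: "int monoid" where
  "sign_group = \<lparr>carrier = {1, -1}, monoid.mult = (*), one = 1\<rparr>"

text \<open>$(\langle g\rangle U, s_{(g,t)})$\<close>

definition gamma_pair ::
  "('g, 'm) monoid_scheme \<Rightarrow> ('g set \<Rightarrow> 'l::lattice set) \<Rightarrow> 'g set \<times> 'l \<Rightarrow> 'g \<Rightarrow> 'g set \<times> 'l"
where
  "gamma_pair G L = (\<lambda>(U, t) g.
     let V = generate G {g} <#>\<^bsub>G\<^esub> U in (V, Inf_fin {s \<in> L V. t \<le> s}))"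

text \<open>The value does not depend on the choice of $g$ with $\sigma = \sigma_g$
  (see \<open>gamma_sigma\<close> below).\<close>

definition gamma ::
  "('g, 'm) monoid_scheme \<Rightarrow> ('g \<Rightarrow> 'l \<Rightarrow> 'l) \<Rightarrow> ('g set \<Rightarrow> 'l::lattice set) \<Rightarrow> ('g set \<times> 'l) set
    \<Rightarrow> ('g set \<times> 'l \<Rightarrow> int) \<Rightarrow> 'g set \<times> 'l \<Rightarrow> ('g set \<Rightarrow> 'g set) \<Rightarrow> int"
where
  "gamma G act L R x p \<sigma> =
     (let g = (SOME g. g \<in> pair_stab G act L p \<and> \<sigma> = sigma G (fst p) g)
      in x (rep G act L R p) * x (rep G act L R (gamma_pair G L p g)))"


section \<open>Well-definedness\<close>

lemma Sup_fin_in: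
  fixes A :: "'l::{finite, lattice} set"
  assumes "A \<noteq> {}" "\<And>x y. x \<in> A \<Longrightarrow> y \<in> A \<Longrightarrow> sup x y \<in> A"
  shows "Sup_fin A \<in> A"
proof -
  have "Sup_fin B \<in> A" if "B \<noteq> {}" "B \<subseteq> A" for B
    using finite[of B] that by (induction B rule: finite_ne_induct) (auto simp: assms(2))
  then show ?thesis using assms(1) by simp
qed

lemma Inf_fin_in:
  fixes A :: "'l::{finite, lattice} set"
  assumes "A \<noteq> {}" "\<And>x y. x \<in> A \<Longrightarrow> y \<in> A \<Longrightarrow> inf x y \<in> A"
  shows "Inf_fin A \<in> A"
proof -
  have "Inf_fin B \<in> A" if "B \<noteq> {}" "B \<subseteq> A" for B
    using finite[of B] that by (induction B rule: finite_ne_induct) (auto simp: assms(2))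
  then show ?thesis using assms(1) by simp
qed

context group
begin

lemma conj_set_subset: "g \<in> carrier G \<Longrightarrow> H \<subseteq> carrier G \<Longrightarrow> conj_set G g H \<subseteq> carrier G"
  unfolding conj_set_def by (simp add: l_coset_subset_G r_coset_subset_G)

lemma conj_set_image: "conj_set G g H = (\<lambda>h. g \<otimes> h \<otimes> inv g) ` H"
  unfolding conj_set_def l_coset_def r_coset_def by auto

lemma conj_set_one: "H \<subseteq> carrier G \<Longrightarrow> conj_set G \<one> H = H"
  unfolding conj_set_def by (simp add: lcos_mult_one coset_mult_one)

lemma conj_set_mult:
  assumes "g \<in> carrier G" "h \<in> carrier G" "H \<subseteq> carrier G"
  shows "conj_set G (g \<otimes> h) H = conj_set G g (conj_set G h H)"
proof -
  have "g \<otimes> h \<otimes> k \<otimes> inv (g \<otimes> h) = g \<otimes> (h \<otimes> k \<otimes> inv h) \<otimes> inv g" if "k \<in> H" for k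
    using assms that by (auto simp: inv_mult_group m_assoc subset_iff)
  then show ?thesis
    unfolding conj_set_image image_image by (intro image_cong) auto
qed

lemma conj_set_subgroup: "subgroup H G \<Longrightarrow> g \<in> carrier G \<Longrightarrow> subgroup (conj_set G g H) G"
  unfolding conj_set_def by (rule subgroup_conjugation_is_surj2)

lemma normalizing_l_eq_r:
  assumes "g \<in> carrier G" "U \<subseteq> carrier G" "conj_set G g U = U"
  shows "g <# U = U #> g"
  using assms unfolding conj_set_def
  by (metis inv_closed coset_mult_assoc coset_mult_one l_coset_subset_G l_inv)

lemma sigma_lcoset:
  assumes U: "subgroup U G" and g: "g \<in> carrier G" and r: "r \<in> carrier G" 
    and n: "conj_set G g U = U"
  shows "sigma G U g (r <# U) = (r \<otimes> g) <# U"
proof -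
  have sub: "U \<subseteq> carrier G" using U by (rule subgroup.subset)
  have "(r <# U) <#> (g <# U) = r <# (U <#> (g <# U))"
    using sub g r by (simp add: l_coset_eq_set_mult set_mult_assoc set_mult_closed)
  also have "g <# U = U #> g" using normalizing_l_eq_r[OF g sub n] .
  also have "U <#> (U #> g) = (U <#> U) #> g"
    using sub g by (simp add: setmult_rcos_assoc)
  also have "U <#> U = U" using U by (rule subgroup_mult_id)
  also have "U #> g = g <# U" using normalizing_l_eq_r[OF g sub n] by simp
  also have "r <# (g <# U) = (r \<otimes> g) <# U" using sub g r by (simp add: lcos_m_assoc)
  finally show ?thesis using r by (auto simp: sigma_def LCOSETS_def)
qed

lemma subgroup_set_mult_normalizing:
  assumes A: "subgroup A G" and U: "subgroup U G" and n: "\<And>a. a \<in> A \<Longrightarrow> conj_set G a U = U"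
  shows "subgroup (A <#> U) G"
proof (rule subgroupI)
  have Ac: "A \<subseteq> carrier G" and Uc: "U \<subseteq> carrier G" using A U by (auto dest: subgroup.subset)
  show "A <#> U \<subseteq> carrier G" using Ac Uc by (rule set_mult_closed)
  show "A <#> U \<noteq> {}"
    using subgroup.one_closed[OF A] subgroup.one_closed[OF U] unfolding set_mult_def by blast
  have cj: "a \<otimes> u \<otimes> inv a \<in> U" if "a \<in> A" "u \<in> U" for a u
    using n[OF that(1)] that(2) unfolding conj_set_image by blast
  show "inv x \<in> A <#> U" if x: "x \<in> A <#> U" for x
  proof -
    obtain a u where au: "a \<in> A" "u \<in> U" "x = a \<otimes> u" using x unfolding set_mult_def by blast
    have c: "a \<in> carrier G" "u \<in> carrier G" using au Ac Uc by auto
    have "inv x = inv a \<otimes> (a \<otimes> inv u \<otimes> inv a)"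
      using c au(3) by (simp add: inv_mult_group m_assoc[symmetric])
    moreover have "inv a \<in> A" using A au(1) by (rule subgroup.m_inv_closed)
    moreover have "a \<otimes> inv u \<otimes> inv a \<in> U" using cj au U by (simp add: subgroup.m_inv_closed)
    ultimately show ?thesis unfolding set_mult_def by blast
  qed
  show "x \<otimes> y \<in> A <#> U" if x: "x \<in> A <#> U" and y: "y \<in> A <#> U" for x y
  proof -
    obtain a u where au: "a \<in> A" "u \<in> U" "x = a \<otimes> u" using x unfolding set_mult_def by blast
    obtain b v where bv: "b \<in> A" "v \<in> U" "y = b \<otimes> v" using y unfolding set_mult_def by blast
    have c: "a \<in> carrier G" "u \<in> carrier G" "b \<in> carrier G" "v \<in> carrier G" 
      using au bv Ac Uc by auto
    have ib: "inv b \<in> A" using A bv(1) by (rule subgroup.m_inv_closed)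
    have w: "inv b \<otimes> u \<otimes> b \<in> U" using cj[OF ib au(2)] c by simp
    have "b \<otimes> (inv b \<otimes> u \<otimes> b \<otimes> v) = u \<otimes> b \<otimes> v"
      using c by (simp add: m_assoc[symmetric])
    then have "x \<otimes> y = (a \<otimes> b) \<otimes> (inv b \<otimes> u \<otimes> b \<otimes> v)"
      using c au(3) bv(3) by (simp add: m_assoc)
    moreover have "a \<otimes> b \<in> A" using A au(1) bv(1) by (rule subgroup.m_closed)
    moreover have "inv b \<otimes> u \<otimes> b \<otimes> v \<in> U" using U w bv(2) by (rule subgroup.m_closed)
    ultimately show ?thesis unfolding set_mult_def by blast
  qed
qed

end

context admissible_family
begin

sublocale group G
  using group_hom group_hom.axioms(1) by auto

lemma pair_group_action: "group_action G (pairs G L) (pair_act G act L)"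
proof -
  let ?P = "pairs G L" and ?f = "pair_act G act L"
  have cl: "?f g p \<in> ?P" if "g \<in> carrier G" "p \<in> ?P" for g p
    using that L_conj conj_set_subgroup by (auto simp: pairs_def pair_act_def)
  have one: "?f \<one> p = p" if "p \<in> ?P" for p
    using that L_fixed[OF _ subgroup.one_closed]
    by (auto simp: pairs_def pair_act_def conj_set_one dest: subgroup.subset)
  have comp: "?f (g \<otimes> h) p = ?f g (?f h p)"
    if "g \<in> carrier G" "h \<in> carrier G" "p \<in> ?P" for g h p
    using that cl[OF that(2,3)] composition_rule
    by (auto simp: pairs_def pair_act_def conj_set_mult dest: subgroup.subset)
  have "bij_betw (?f g) ?P ?P" if g: "g \<in> carrier G" for g
  proof (rule bij_betw_byWitness[where f' = "?f (inv g)"])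
    show "\<forall>p\<in>?P. ?f (inv g) (?f g p) = p" "\<forall>p\<in>?P. ?f g (?f (inv g) p) = p"
      using comp[symmetric] g one by auto
    show "?f g ` ?P \<subseteq> ?P" "?f (inv g) ` ?P \<subseteq> ?P" using cl g by auto
  qed
  then have bij: "?f g \<in> Bij ?P" if "g \<in> carrier G" for g
    using that by (simp add: Bij_def pair_act_def)
  have "?f (g \<otimes> h) = compose ?P (?f g) (?f h)"
    if "g \<in> carrier G" "h \<in> carrier G" for g h
  proof
    fix p
    show "?f (g \<otimes> h) p = compose ?P (?f g) (?f h) p"
      using comp that by (cases "p \<in> ?P") (auto simp: compose_def pair_act_def)
  qed
  then have "?f \<in> hom G (BijGroup ?P)"
    using bij by (auto simp: hom_def BijGroup_def)
  then show ?thesis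
    using group_BijGroup group_axioms
    by (auto simp: group_action_def group_hom_def group_hom_axioms_def)
qed

lemma rep_in_orbit:
  assumes "orbit_reps G act L R" "p \<in> pairs G L"
  shows "rep G act L R p \<in> R" "rep G act L R p \<in> orbit G (pair_act G act L) p"
  using theI'[of "\<lambda>q. q \<in> R \<and> q \<in> orbit G (pair_act G act L) p"] assms
  unfolding orbit_reps_def rep_def by blast+

lemma rep_of_rep:
  assumes "orbit_reps G act L R" "p \<in> R"
  shows "rep G act L R p = p"
proof -
  have p: "p \<in> pairs G L" using assms by (auto simp: orbit_reps_def)
  have "p \<in> orbit G (pair_act G act L) p"
    using group_action.orbit_refl[OF pair_group_action p] .
  then show ?thesis
    using assms p rep_in_orbit[OF assms(1) p] unfolding orbit_reps_def by blast
qed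

lemma pair_stab_iff:
  assumes "(U, t) \<in> pairs G L"
  shows "g \<in> pair_stab G act L (U, t) \<longleftrightarrow> g \<in> carrier G \<and> conj_set G g U = U \<and> act g t = t"
  using assms by (auto simp: pair_stab_def stabilizer_def pair_act_def)

lemma gamma_pair_subgroup:
  assumes p: "(U, t) \<in> pairs G L" and g: "g \<in> pair_stab G act L (U, t)"
  shows "subgroup (generate G {g} <#> U) G"
proof (rule subgroup_set_mult_normalizing)
  have gc: "g \<in> carrier G" using p g by (simp add: pair_stab_iff)
  show "subgroup (generate G {g}) G" using gc by (simp add: generate_is_subgroup)
  show "subgroup U G" using p by (simp add: pairs_def)
  have "subgroup (pair_stab G act L (U, t)) G"
    unfolding pair_stab_def using group_action.stabilizer_subgroup[OF pair_group_action p] .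
  then have "generate G {g} \<subseteq> pair_stab G act L (U, t)"
    using g generate_subgroup_incl by blast
  then show "conj_set G a U = U" if "a \<in> generate G {g}" for a
    using p that pair_stab_iff by blast
qed

lemma gamma_pair_in_pairs:
  assumes p: "(U, t) \<in> pairs G L" and g: "g \<in> pair_stab G act L (U, t)"
  shows "gamma_pair G L (U, t) g \<in> pairs G L"
proof -
  define V where "V = generate G {g} <#> U"
  have U: "subgroup U G" and t: "t \<in> L U" using p by (auto simp: pairs_def)
  have V: "subgroup V G" unfolding V_def using p g by (rule gamma_pair_subgroup)
  have "\<one> \<in> generate G {g}" by (rule generate.one)
  then have "U \<subseteq> V" unfolding V_def set_mult_def using subgroup.subset[OF U] by force
  then have "Sup_fin (L U) \<le> Sup_fin (L V)" using L_Sup_mono[OF V U] by simp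
  moreover have "t \<le> Sup_fin (L U)" using t by (simp add: Sup_fin.coboundedI)
  ultimately have le: "t \<le> Sup_fin (L V)" by simp
  have SupV: "Sup_fin (L V) \<in> L V"
    using L_nonempty[OF V] L_sublattice[OF V] by (intro Sup_fin_in) (auto simp: sublattice_def)
  have ne: "{s \<in> L V. t \<le> s} \<noteq> {}" using le SupV by blast
  have "Inf_fin {s \<in> L V. t \<le> s} \<in> {s \<in> L V. t \<le> s}"
    using ne L_sublattice[OF V] by (intro Inf_fin_in) (auto simp: sublattice_def)
  then show ?thesis using V by (simp add: gamma_pair_def V_def[symmetric] Let_def pairs_def)
qed

lemma sigma_eq_iff:
  assumes p: "(U, t) \<in> pairs G L"
    and g: "g \<in> pair_stab G act L (U, t)" and h: "h \<in> pair_stab G act L (U, t)"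
    and eq: "sigma G U g = sigma G U h"
  shows "generate G {g} <#> U \<subseteq> generate G {h} <#> U"
proof -
  have U: "subgroup U G" using p by (simp add: pairs_def)
  have gc: "g \<in> carrier G" "conj_set G g U = U" and hc: "h \<in> carrier G" "conj_set G h U = U"
    using p g h by (auto simp: pair_stab_iff)
  let ?V = "generate G {h} <#> U"
  have V: "subgroup ?V G" using p h by (rule gamma_pair_subgroup)
  have "g <# U = h <# U"
    using fun_cong[OF eq, of "\<one> <# U"] sigma_lcoset[OF U gc(1) one_closed gc(2)]
      sigma_lcoset[OF U hc(1) one_closed hc(2)] gc hc by simp
  then have "g \<in> h <# U" using lcos_self[OF gc(1) U] by simp
  moreover have "h \<in> generate G {h}" by (simp add: generate.incl)
  ultimately have "g \<in> ?V" unfolding l_coset_def set_mult_def by blast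
  then have gV: "generate G {g} \<subseteq> ?V" using generate_subgroup_incl[OF _ V] by simp
  have "\<one> \<in> generate G {h}" by (rule generate.one)
  then have UV: "U \<subseteq> ?V" unfolding set_mult_def using subgroup.subset[OF U] by force
  show ?thesis
    using gV UV subgroup.m_closed[OF V] unfolding set_mult_def[of _ "generate G {g}"] by blast
qed

theorem gamma_sigma:
  assumes p: "(U, t) \<in> pairs G L" and g: "g \<in> pair_stab G act L (U, t)"
  shows "gamma G act L R x (U, t) (sigma G U g) =
    x (rep G act L R (U, t)) * x (rep G act L R (gamma_pair G L (U, t) g))"
proof -
  define h where "h = (SOME h. h \<in> pair_stab G act L (U, t) \<and> sigma G U g = sigma G U h)"
  have h: "h \<in> pair_stab G act L (U, t)" "sigma G U g = sigma G U h"
    using someI[of "\<lambda>h. h \<in> pair_stab G act L (U, t) \<and> sigma G U g = sigma G U h" g] g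
    unfolding h_def by auto
  have "generate G {g} <#> U = generate G {h} <#> U"
    using sigma_eq_iff[OF p g h(1) h(2)] sigma_eq_iff[OF p h(1) g h(2)[symmetric]] by blast
  then show ?thesis by (simp add: gamma_def h_def[symmetric] gamma_pair_def)
qed

end

end

theory Submission
  imports Defs
begin

text \<open>
  For \<open>(U, t)\<close> with stabilizer \<open>N\<close> put \<open>f n = x (\<langle>n\<rangle>U, t')\<close>, where \<open>t'\<close> is the least element of
  \<open>L (\<langle>n\<rangle>U)\<close> above \<open>t\<close>. Everything rests on one observation
  (\<open>stab_fixed_marked_cosets\<close>): \<open>N\<close> acts by left translation on the cosets which the mark of
  \<open>(K, s)\<close> at \<open>(U, t)\<close> counts, and the fixed points of \<open>n\<close> are exactly the cosets counted by the mark
  at \<open>(\<langle>n\<rangle>U, t')\<close>. Hence, if \<open>x\<close> is in the image, \<open>f\<close> is an integral combination of permutation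
  characters of \<open>N\<close>.

  A virtual permutation character with values \<open>1\<close> and \<open>- 1\<close> is a linear character up to a global
  sign (\<open>unit_virtual_permutation_character_mult\<close>): it agrees, up to that sign, with its
  determinant, the product of the signs of the permutations involved. The proof compares both on
  cyclic subgroups, where the sign of a permutation is given by its number of cycles and Burnside's
  lemma expresses the number of cycles as an average of fixed point counts. So \<open>f \<one> * f\<close>, which is the
  map \<open>\<gamma>\<close>, is a homomorphism.

  Conversely, the image can be described by congruences
  (\<open>mark_combination_iff_congruences\<close>): an integral vector \<open>y\<close> is in the image iff, for each
  representative \<open>(U, t)\<close>, the sum of \<open>y (\<langle>n\<rangle>U, t')\<close> over \<open>n\<close> in \<open>N\<close> is divisible by the order of
  \<open>N\<close>. Necessity is Burnside's lemma again. Sufficiency holds because the table of marks is triangular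
  for a suitable rank, and the congruence at a representative of largest rank in the support of \<open>y\<close>
  says that the diagonal mark divides the value there. If \<open>\<gamma>\<close> is a homomorphism to the signs, its sum
  over \<open>N\<close> is zero or the order of \<open>N\<close>, and the congruences hold.
\<close>

section \<open>The sign of a permutation and its number of cycles\<close>

definition cycles :: "('a \<Rightarrow> 'a) \<Rightarrow> 'a set \<Rightarrow> 'a set set" where
  "cycles p A = (\<lambda>x. range (\<lambda>k. (p ^^ k) x)) ` A"

lemma cycle_through_eq:
  assumes p: "p permutes A" and fin: "finite A" and y: "y \<in> range (\<lambda>k. (p ^^ k) x)"
  shows "range (\<lambda>k. (p ^^ k) y) = range (\<lambda>k. (p ^^ k) x)"
proof -
  obtain j where j: "y = (p ^^ j) x" using y by blast
  obtain n where n: "p ^^ n = id" "n > 0"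
    using permutation_is_nilpotent[OF permutes_imp_permutation[OF fin p]] by blast
  have "(p ^^ k) y = (p ^^ (k + j)) x" for k by (simp add: j funpow_add)
  moreover have "(p ^^ k) x \<in> range (\<lambda>k. (p ^^ k) y)" for k
  proof -
    have "(p ^^ (n * j)) = id" by (simp add: funpow_mult[symmetric] n(1))
    then have "(p ^^ k) x = (p ^^ (k + n * j)) x" by (simp add: funpow_add)
    also have "k + n * j = (k + (n * j - j)) + j" using n(2) by (cases n) auto
    also have "(p ^^ \<dots>) x = (p ^^ (k + (n * j - j))) y" by (simp add: j funpow_add)
    finally show ?thesis by blast
  qed
  ultimately show ?thesis by blast
qed

text \<open>Composing \<open>p\<close> with the transposition of \<open>a\<close> and \<open>p a\<close> shortcuts \<open>a\<close>: the predecessor of \<open>a\<close> is sent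
  straight to \<open>p a\<close>, and \<open>a\<close> becomes a fixed point. All cycles survive with \<open>a\<close> deleted, which
  drives the induction on the size of the set in the next lemma.\<close>

lemma cycle_skip:
  assumes p: "p permutes A" and pa: "p a \<noteq> a" and x: "x \<noteq> a"
  defines "q \<equiv> Transposition.transpose a (p a) \<circ> p"
  shows "range (\<lambda>k. (q ^^ k) x) = range (\<lambda>k. (p ^^ k) x) - {a}"
proof -
  have inj: "p u = p v \<longleftrightarrow> u = v" for u v
    using permutes_inj[OF p] by (auto dest: injD)
  have q: "q y = (if p y = a then p a else p y)" if "y \<noteq> a" for y
    using that inj[of y a] by (auto simp: q_def Transposition.transpose_def)
  have "(q ^^ k) x \<noteq> a \<and> (q ^^ k) x \<in> range (\<lambda>k. (p ^^ k) x)" for k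
  proof (induction k)
    case 0
    then show ?case using x by (auto intro: range_eqI[where x = 0])
  next
    case (Suc k)
    then obtain i where i: "(q ^^ k) x = (p ^^ i) x" by blast
    then show ?case using Suc pa q[of "(q ^^ k) x"] inj
      by (auto intro: range_eqI[where x = "Suc i"] range_eqI[where x = "Suc (Suc i)"])
  qed
  moreover have "(p ^^ k) x \<noteq> a \<longrightarrow> (p ^^ k) x \<in> range (\<lambda>k. (q ^^ k) x)" for k
  proof (induction k rule: less_induct)
    case (less k)
    have step: "q y \<in> range (\<lambda>k. (q ^^ k) x)" if "y \<in> range (\<lambda>k. (q ^^ k) x)" for y
      using that by (auto intro: range_eqI[where x = "Suc i" for i])
    show ?case
    proof (cases k)
      case 0
      then show ?thesis by (auto intro: range_eqI[where x = 0])
    next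
      case (Suc i)
      show ?thesis
      proof (cases "(p ^^ i) x = a")
        case False
        then show ?thesis using Suc less[of i] step[of "(p ^^ i) x"] q[of "(p ^^ i) x"] by auto
      next
        \<comment> \<open>The step of \<open>p\<close> out of \<open>a\<close> completes a single step of \<open>q\<close> that jumps over \<open>a\<close>.\<close>
        case True
        then obtain m where m: "i = Suc m" using x by (cases i) auto
        then have "(p ^^ m) x \<noteq> a" using True pa by auto
        then show ?thesis
          using Suc m True less[of m] step[of "(p ^^ m) x"] q[of "(p ^^ m) x"] by auto
      qed
    qed
  qed
  ultimately show ?thesis by blast
qed

text \<open>Delete one point \<open>a\<close> at a time. A fixed point is a cycle of its own, so both counts drop by one.
  A point that is moved is first turned into a fixed point by a transposition: the sign changes, the
  number of points drops by one, and the number of cycles stays the same.\<close>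

lemma sign_eq_card_cycles:
  assumes "p permutes A" "finite A"
  shows "sign p = (- 1) ^ (card A + card (cycles p A))"
  using assms
proof (induction "card A" arbitrary: A p)
  case 0
  then show ?case by (simp add: cycles_def)
next
  case (Suc n)
  note p = \<open>p permutes A\<close> and fin = \<open>finite A\<close>
  obtain a where a: "a \<in> A" using Suc.hyps(2) by (metis card.empty ex_in_conv nat.distinct(1))
  let ?Y = "A - {a}"
  have n: "n = card ?Y" using Suc.hyps(2) a fin by simp
  have cA: "card A = Suc n" using Suc.hyps(2) by simp
  show ?case
  proof (cases "p a = a")
    case True
    have pY: "p permutes ?Y"
      using p True by (auto intro: permutes_superset)
    have fix': "(p ^^ k) a = a" for k using True by (induction k) auto
    have "cycles p A = cycles p (insert a ?Y)" using a by (simp add: insert_absorb)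
    also have "\<dots> = insert {a} (cycles p ?Y)" unfolding cycles_def image_insert using fix' by simp
    finally have "cycles p A = insert {a} (cycles p ?Y)" .
    moreover have "{a} \<notin> cycles p ?Y"
    proof
      assume "{a} \<in> cycles p ?Y"
      then obtain y where "y \<noteq> a" "{a} = range (\<lambda>k. (p ^^ k) y)" by (auto simp: cycles_def)
      moreover have "y \<in> range (\<lambda>k. (p ^^ k) y)" by (auto intro: range_eqI[where x = 0])
      ultimately show False by auto
    qed
    moreover have "finite (cycles p ?Y)" using fin by (simp add: cycles_def)
    ultimately have "card (cycles p A) = Suc (card (cycles p ?Y))" by simp
    then show ?thesis using Suc.hyps(1)[OF n pY] fin cA n by simp
  next
    case False
    define q where "q = Transposition.transpose a (p a) \<circ> p"
    have pa: "p a \<in> A" using p a by (simp add: permutes_in_image)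
    have "q permutes A" unfolding q_def
      using p a pa by (intro permutes_compose permutes_swap_id)
    then have qY: "q permutes ?Y"
      by (auto intro: permutes_superset simp: q_def)
    have skip: "range (\<lambda>k. (q ^^ k) x) = range (\<lambda>k. (p ^^ k) x) - {a}" if "x \<noteq> a" for x
      unfolding q_def using cycle_skip[OF p False that] .
    have self: "x \<in> range (\<lambda>k. (p ^^ k) x)" for x by (auto intro: range_eqI[where x = 0])
    have aY: "range (\<lambda>k. (p ^^ k) a) = range (\<lambda>k. (p ^^ k) (p a))"
      by (rule cycle_through_eq[OF p fin, symmetric]) (auto intro: range_eqI[where x = 1])
    have AY: "cycles p A = (\<lambda>x. range (\<lambda>k. (p ^^ k) x)) ` ?Y"
      unfolding cycles_def using aY pa False by (auto simp: image_iff)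
    have "cycles q ?Y = (\<lambda>D. D - {a}) ` cycles p A"
      unfolding cycles_def[of q] AY image_image using skip by (intro image_cong) auto
    moreover have "inj_on (\<lambda>D. D - {a}) (cycles p A)"
    proof (rule inj_onI)
      fix C D assume AB: "C \<in> cycles p A" "D \<in> cycles p A" "C - {a} = D - {a}"
      obtain x y where xy: "x \<noteq> a" "C = range (\<lambda>k. (p ^^ k) x)" "D = range (\<lambda>k. (p ^^ k) y)"
        using AB(1,2) unfolding AY by blast
      have "x \<in> D" using AB(3) xy self[of x] by blast
      then show "C = D" using xy cycle_through_eq[OF p fin] by simp
    qed
    ultimately have "card (cycles q ?Y) = card (cycles p A)" by (simp add: card_image)
    then have "sign q = (- 1) ^ (n + card (cycles p A))"
      using Suc.hyps(1)[OF n qY] fin n by simp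
    moreover have "sign q = - sign p"
    proof -
      have "permutation p" using p fin permutes_imp_permutation by blast
      then show ?thesis
        unfolding q_def using False
        by (subst sign_compose) (auto simp: sign_swap_id permutation_swap_id)
    qed
    ultimately show ?thesis using cA by simp
  qed
qed


section \<open>Virtual permutation characters with values of modulus one\<close>

text \<open>The orbits of the cyclic group generated by \<open>h\<close> are the cycles of the permutation by which \<open>h\<close>
  acts.\<close>

lemma (in group_action) sign_on_action_eq:
  assumes fin: "finite E" "finite (carrier G)" and h: "h \<in> carrier G"
  shows "sign_on E (\<phi> h) = (- 1) ^ (card E + card (orbits (G\<lparr>carrier := generate G {h}\<rparr>) E \<phi>))"
proof -
  interpret group G using group_hom group_hom.axioms(1) by blast
  define p where "p = restrict_id (\<phi> h) E"
  have "bij_betw (\<phi> h) E E" using bij_prop0[OF h] by (simp add: Bij_def)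
  then have p: "p permutes E" unfolding p_def by (rule permutes_restrict_id)
  have pow: "(p ^^ k) y = \<phi> (h [^] k) y \<and> (p ^^ k) y \<in> E" if y: "y \<in> E" for k :: nat and y
  proof (induction k)
    case 0
    have "\<phi> \<one> y = y" using fun_cong[OF id_eq_one, of y] y by simp
    then show ?case using y by simp
  next
    case (Suc k)
    have "h [^] Suc k = h \<otimes> h [^] k" using h by (simp only: nat_pow_Suc2)
    moreover have "p z = \<phi> h z" if "z \<in> E" for z using that by (simp add: p_def restrict_id_def)
    then have "p ((p ^^ k) y) = \<phi> h ((p ^^ k) y)" using Suc.IH by blast
    moreover have "\<phi> h ((p ^^ k) y) \<in> E" using Suc.IH element_image[OF h] by blast
    ultimately show ?case
      using Suc.IH h y by (simp add: composition_rule del: nat_pow_Suc)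
  qed
  have "orbits (G\<lparr>carrier := generate G {h}\<rparr>) E \<phi> = cycles p E"
    using generate_pow_on_finite_carrier[OF fin(2) h] pow
    by (auto simp: orbits_def cycles_def orbit_def image_iff setcompr_eq_image image_image)
  then show ?thesis
    using sign_eq_card_cycles[OF p fin(1)] by (simp add: sign_on_def p_def)
qed

lemma (in group_action) sum_invariants_eq:
  assumes fin: "finite E" "finite (carrier G)" and H: "subgroup H G"
  shows "(\<Sum>h\<in>H. int (card (invariants E \<phi> h))) =
    int (card (orbits (G\<lparr>carrier := H\<rparr>) E \<phi>)) * int (card H)"
proof -
  interpret H: group_action "G\<lparr>carrier := H\<rparr>" E \<phi> using induced_action[OF H] .
  have "finite H" using finite_subset[OF subgroup.subset[OF H] fin(2)] .
  then show ?thesis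
    using arg_cong[OF H.burnside[OF _ fin(1)], of int] by (simp add: order_def)
qed

lemma (in group_action) sign_on_action_mult:
  assumes fin: "finite E" and gh: "g \<in> carrier G" "h \<in> carrier G"
  shows "sign_on E (\<phi> (g \<otimes> h)) = sign_on E (\<phi> g) * sign_on E (\<phi> h)"
proof -
  have "sign_on E (\<phi> (g \<otimes> h)) = sign_on E (\<phi> g \<circ> \<phi> h)"
    using gh composition_rule by (intro sign_on_cong) auto
  also have "\<dots> = sign_on E (\<phi> g) * sign_on E (\<phi> h)"
    using gh fin bij_prop0 by (intro sign_on_compose) (auto simp: Bij_def)
  finally show ?thesis .
qed

text \<open>An average of signs that is a nonzero integer must be \<open>1\<close> or \<open>- 1\<close>, and this extreme value is only
  reached when all the signs agree.\<close>

lemma sum_zero_or_constant: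
  fixes f :: "'a \<Rightarrow> int"
  assumes fin: "finite C" and f: "\<And>m. m \<in> C \<Longrightarrow> f m \<in> {1, - 1}"
    and sum: "sum f C = a * int (card C)" and a: "a \<noteq> 0" and m: "m \<in> C"
  shows "f m = sgn a"
proof -
  have nn: "0 \<le> 1 - sgn a * f m" if "m \<in> C" for m
    using f[OF that] by (auto simp: sgn_if)
  have "(\<Sum>m\<in>C. 1 - sgn a * f m) = int (card C) - sgn a * a * int (card C)"
    by (simp add: sum_subtractf sum_distrib_left[symmetric] sum)
  also have "\<dots> = (1 - \<bar>a\<bar>) * int (card C)" by (simp add: algebra_simps abs_sgn)
  also have "\<dots> \<le> 0" using a by (intro mult_nonpos_nonneg) auto
  finally have "(\<Sum>m\<in>C. 1 - sgn a * f m) = 0" using sum_nonneg[of C "\<lambda>m. 1 - sgn a * f m"] nn by force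
  then have "1 - sgn a * f m = 0" using sum_nonneg_eq_0_iff[OF fin nn] m by simp
  then show ?thesis using f[OF m] a by (auto simp: sgn_if split: if_splits)
qed

text \<open>Translation by an element of value \<open>- 1\<close> permutes the summands and negates the sum.\<close>

lemma (in group) sum_sign_character_eq_0:
  fixes \<chi> :: "'a \<Rightarrow> int"
  assumes H: "subgroup H G" and mult: "\<And>g k. g \<in> H \<Longrightarrow> k \<in> H \<Longrightarrow> \<chi> (g \<otimes> k) = \<chi> g * \<chi> k"
    and h: "h \<in> H" "\<chi> h = - 1"
  shows "(\<Sum>m\<in>H. \<chi> m) = 0"
proof -
  note closed = subgroup.mem_carrier[OF H] subgroup.m_closed[OF H] subgroup.m_inv_closed[OF H]
  have "bij_betw (\<lambda>m. h \<otimes> m) H H"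
  proof (rule bij_betw_byWitness[where f' = "\<lambda>m. inv h \<otimes> m"])
    show "\<forall>m\<in>H. inv h \<otimes> (h \<otimes> m) = m" "\<forall>m\<in>H. h \<otimes> (inv h \<otimes> m) = m"
      using closed h by (simp_all add: m_assoc[symmetric])
    show "(\<lambda>m. h \<otimes> m) ` H \<subseteq> H" "(\<lambda>m. inv h \<otimes> m) ` H \<subseteq> H"
      using closed h by auto
  qed
  then have "(\<Sum>m\<in>H. \<chi> m) = (\<Sum>m\<in>H. \<chi> (h \<otimes> m))" by (rule sum.reindex_bij_betw[symmetric])
  also have "\<dots> = (\<Sum>m\<in>H. - \<chi> m)" using h mult by (intro sum.cong) auto
  finally show ?thesis by (simp add: sum_negf)
qed

text \<open>A virtual permutation character with values \<open>1\<close> and \<open>- 1\<close> is, up to a global sign, a linear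
  character. Character theory derives this from the norm of \<open>f\<close> being \<open>1\<close>; the proof here uses
  determinants, that is, signs of permutations, and only counts points. Let \<open>det\<close> be the product of
  the signs with which an element acts on the sets \<open>E q\<close>, raised to the power \<open>\<bar>c q\<bar>\<close>. It is
  multiplicative, and it turns out to be equal to \<open>f \<one> * f h\<close>.

  Let \<open>n h\<close> be the average of \<open>f\<close> over the cyclic group generated by \<open>h\<close>. By Burnside's lemma it is
  the virtual number of orbits, an integer, so \<open>det h\<close> is given by the parity of \<open>f \<one> + n h\<close>, where
  \<open>f \<one>\<close> is odd. If \<open>det h = 1\<close>, then \<open>n h\<close> is odd, hence nonzero, so \<open>f\<close> is constant on that cyclic
  group and \<open>f \<one> * f h = 1\<close>. Consequently \<open>det \<le> f \<one> * f\<close> everywhere. If \<open>det h = - 1\<close>, then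
  \<open>n h\<close> is even; an average of signs cannot be even unless it is \<open>0\<close>. Both sides of the inequality then
  have sum \<open>0\<close> over the cyclic group, and they agree on it.\<close>

theorem (in group) unit_virtual_permutation_character_mult:
  fixes f :: "'a \<Rightarrow> int"
  assumes finG: "finite (carrier G)" and finQ: "finite Q"
    and act: "\<And>q. q \<in> Q \<Longrightarrow> group_action G (E q) (\<phi> q)"
    and finE: "\<And>q. q \<in> Q \<Longrightarrow> finite (E q)"
    and f: "\<And>h. h \<in> carrier G \<Longrightarrow> f h = (\<Sum>q\<in>Q. c q * int (card (invariants (E q) (\<phi> q) h)))"
    and unit: "\<And>h. h \<in> carrier G \<Longrightarrow> f h \<in> {1, - 1}"
    and g: "g \<in> carrier G" and h: "h \<in> carrier G"
  shows "f \<one> * f (g \<otimes> h) = (f \<one> * f g) * (f \<one> * f h)"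
proof -
  (* Signs are their own inverses, so the exponent matters only through its parity. *)
  define det where "det h = (\<Prod>q\<in>Q. sign_on (E q) (\<phi> q h) ^ nat \<bar>c q\<bar>)" for h
  have det_mult: "det (g \<otimes> h) = det g * det h" if "g \<in> carrier G" "h \<in> carrier G" for g h
    unfolding det_def prod.distrib[symmetric]
    using that act finE
    by (intro prod.cong refl)
      (simp add: group_action.sign_on_action_mult power_mult_distrib)
  have det_unit: "det h = 1 \<or> det h = - 1" for h
  proof -
    have "\<bar>det h\<bar> = 1" by (simp add: det_def abs_prod power_abs sign_on_def)
    then show ?thesis by linarith
  qed
  (* The virtual number of orbits of the cyclic group generated by h. *)
  define n where "n h = (\<Sum>q\<in>Q. c q * int (card (orbits (G\<lparr>carrier := generate G {h}\<rparr>) (E q) (\<phi> q))))" for h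
  have f_one: "f \<one> = (\<Sum>q\<in>Q. c q * int (card (E q)))"
  proof -
    have "invariants (E q) (\<phi> q) \<one> = E q" if "q \<in> Q" for q
      unfolding invariants_def group_action.id_eq_one[OF act[OF that], symmetric] by auto
    then show ?thesis by (simp add: f)
  qed
  have sum_f: "(\<Sum>m\<in>generate G {h}. f m) = n h * int (card (generate G {h}))"
    if h: "h \<in> carrier G" for h
  proof -
    have sub: "subgroup (generate G {h}) G" using h by (simp add: generate_is_subgroup)
    have "(\<Sum>m\<in>generate G {h}. f m) =
      (\<Sum>m\<in>generate G {h}. \<Sum>q\<in>Q. c q * int (card (invariants (E q) (\<phi> q) m)))"
      using subgroup.mem_carrier[OF sub] f by (intro sum.cong) auto
    also have "\<dots> = (\<Sum>q\<in>Q. c q * (\<Sum>m\<in>generate G {h}. int (card (invariants (E q) (\<phi> q) m))))"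
      by (subst sum.swap) (simp add: sum_distrib_left)
    also have "\<dots> = (\<Sum>q\<in>Q. c q * (int (card (orbits (G\<lparr>carrier := generate G {h}\<rparr>) (E q) (\<phi> q)))
        * int (card (generate G {h}))))"
      using group_action.sum_invariants_eq[OF act finE finG sub] by (intro sum.cong) auto
    finally show ?thesis by (simp add: n_def sum_distrib_right mult.assoc)
  qed
  have det_parity: "det h = 1 \<longleftrightarrow> odd (n h)" if h: "h \<in> carrier G" for h
  proof -
    let ?k = "\<lambda>q. card (E q) + card (orbits (G\<lparr>carrier := generate G {h}\<rparr>) (E q) (\<phi> q))"
    have "det h = (\<Prod>q\<in>Q. (- 1) ^ (?k q * nat \<bar>c q\<bar>))"
      unfolding det_def using group_action.sign_on_action_eq[OF act finE finG h]
      by (intro prod.cong) (simp_all add: power_mult)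
    also have "\<dots> = (- 1) ^ (\<Sum>q\<in>Q. ?k q * nat \<bar>c q\<bar>)" by (simp add: power_sum)
    finally have "det h = 1 \<longleftrightarrow> even (int (\<Sum>q\<in>Q. ?k q * nat \<bar>c q\<bar>))"
      unfolding even_of_nat by (simp add: minus_one_power_iff)
    moreover have "even (int (\<Sum>q\<in>Q. ?k q * nat \<bar>c q\<bar>) - (f \<one> + n h))"
    proof -
      have "int (\<Sum>q\<in>Q. ?k q * nat \<bar>c q\<bar>) - (f \<one> + n h) = (\<Sum>q\<in>Q. int (?k q) * (\<bar>c q\<bar> - c q))"
        by (simp add: f_one n_def sum_subtractf sum.distrib algebra_simps)
      moreover have "even \<dots>" by (intro dvd_sum) (auto simp: abs_if)
      ultimately show ?thesis by simp
    qed
    moreover have "odd (f \<one>)" using unit[OF one_closed] by auto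
    ultimately show ?thesis by (simp del: of_nat_sum)
  qed
  have gen: "m \<in> carrier G" if "h \<in> carrier G" "m \<in> generate G {h}" for h m
    using generate_in_carrier[of "{h}" m] that by simp
  have gen_fin: "finite (generate G {h})" if "h \<in> carrier G" for h
    using finite_subset[OF _ finG] gen[OF that] by blast
  have const: "f m = sgn (n h)" if "h \<in> carrier G" "n h \<noteq> 0" "m \<in> generate G {h}" for h m
    using sum_zero_or_constant[OF gen_fin _ sum_f, of h m] unit gen that by blast
  have det_one: "f \<one> * f h = 1" if h: "h \<in> carrier G" and d: "det h = 1" for h
  proof -
    have "n h \<noteq> 0" using det_parity[OF h] d by auto
    then have "f h = sgn (n h)" "f \<one> = sgn (n h)"
      using const[OF h] by (simp_all add: generate.incl generate.one)
    then show ?thesis using unit[OF h] by auto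
  qed
  have det_le: "det m \<le> f \<one> * f m" if "m \<in> carrier G" for m
    using det_one[OF that] det_unit[of m] unit[OF that] unit[OF one_closed] by auto
  have key: "f \<one> * f h = det h" if h: "h \<in> carrier G" for h
  proof (cases "det h = 1")
    case True
    then show ?thesis using det_one[OF h] by simp
  next
    case False
    then have d: "det h = - 1" using det_unit[of h] by simp
    let ?C = "generate G {h}"
    have sub: "subgroup ?C G" using h by (simp add: generate_is_subgroup)
    have "n h = 0"
    proof (rule ccontr)
      assume nz: "n h \<noteq> 0"
      have "n h * int (card ?C) = (\<Sum>m\<in>?C. sgn (n h))"
        unfolding sum_f[OF h, symmetric] using const[OF h nz] by (intro sum.cong) auto
      then have "n h * int (card ?C) = sgn (n h) * int (card ?C)" by simp
      moreover have "card ?C \<noteq> 0" using gen_fin[OF h] generate.one[of G "{h}"] by auto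
      ultimately have "n h = sgn (n h)" by simp
      then have "odd (n h)" using nz by (metis odd_one even_minus sgn_if)
      then show False using det_parity[OF h] False by simp
    qed
    then have "(\<Sum>m\<in>?C. f \<one> * f m) = 0" using sum_f[OF h] by (simp add: sum_distrib_left[symmetric])
    moreover have "(\<Sum>m\<in>?C. det m) = 0"
    proof -
      have "\<And>g k. g \<in> ?C \<Longrightarrow> k \<in> ?C \<Longrightarrow> det (g \<otimes> k) = det g * det k"
        using gen[OF h] det_mult by blast
      then show ?thesis
        using sum_sign_character_eq_0[of ?C det h] sub d by (simp add: generate.incl)
    qed
    ultimately have "(\<Sum>m\<in>?C. f \<one> * f m - det m) = 0" by (simp add: sum_subtractf)
    then have "\<forall>m\<in>?C. f \<one> * f m - det m = 0"
      using det_le gen[OF h] by (subst (asm) sum_nonneg_eq_0_iff) (auto simp: gen_fin[OF h])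
    then show ?thesis by (simp add: generate.incl)
  qed
  show ?thesis using key g h by (simp add: det_mult)
qed


section \<open>Stabilizers acting on marked cosets\<close>

text \<open>The set whose cardinality is \<^const>\<open>mark\<close>. It is kept as a set because the stabilizer of the
  first pair acts on it by left translation.\<close>

definition marked_cosets ::
  "('g, 'm) monoid_scheme \<Rightarrow> ('g \<Rightarrow> 'l \<Rightarrow> 'l) \<Rightarrow> 'g set \<times> 'l::lattice \<Rightarrow> 'g set \<times> 'l \<Rightarrow> 'g set set"
where
  "marked_cosets G act = (\<lambda>(U, t) (K, s).
     {g <#\<^bsub>G\<^esub> K | g. g \<in> carrier G \<and> U \<subseteq> conj_set G g K \<and> t \<le> act g s})"

lemma mark_eq_card: "mark G act p q = card (marked_cosets G act p q)"
  by (auto simp: mark_def marked_cosets_def split: prod.split)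

context group
begin

lemma conj_set_mono: "A \<subseteq> B \<Longrightarrow> conj_set G g A \<subseteq> conj_set G g B"
  unfolding conj_set_image by blast

lemma card_conj_set:
  assumes "g \<in> carrier G" "A \<subseteq> carrier G"
  shows "card (conj_set G g A) = card A"
proof -
  have "inj_on (\<lambda>h. g \<otimes> h \<otimes> inv g) A"
    using assms conjugation_is_inj by (intro inj_onI) blast
  then show ?thesis unfolding conj_set_image by (rule card_image)
qed

lemma conj_set_self:
  assumes H: "subgroup H G" and h: "h \<in> H"
  shows "conj_set G h H = H"
proof -
  have c: "h \<in> carrier G" "H \<subseteq> carrier G" using H h subgroup.subset by auto
  have "h <# H = H"
    using l_repr_independence[OF _ one_closed H, of h] h c by (simp add: lcos_mult_one)
  moreover have "H #> inv h = H"
    using coset_join2[OF _ H] h c subgroup.m_inv_closed[OF H] by simp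
  ultimately show ?thesis by (simp add: conj_set_def)
qed

lemma l_coset_fixed_iff:
  assumes K: "subgroup K G" and g: "g \<in> carrier G" and n: "n \<in> carrier G"
  shows "n <# (g <# K) = g <# K \<longleftrightarrow> n \<in> conj_set G g K"
proof -
  have sub: "K \<subseteq> carrier G" using K by (rule subgroup.subset)
  have "n <# (g <# K) = g <# K \<longleftrightarrow> n \<otimes> g \<in> g <# K"
  proof
    assume "n <# (g <# K) = g <# K"
    then show "n \<otimes> g \<in> g <# K" using lcos_self[of "n \<otimes> g" K] K sub g n by (simp add: lcos_m_assoc)
  next
    assume "n \<otimes> g \<in> g <# K"
    then show "n <# (g <# K) = g <# K"
      using l_repr_independence[OF _ g K] sub g n by (simp add: lcos_m_assoc)
  qed
  also have "\<dots> \<longleftrightarrow> (\<exists>k\<in>K. n \<otimes> g = g \<otimes> k)" by (auto simp: l_coset_def)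
  also have "\<dots> \<longleftrightarrow> (\<exists>k\<in>K. n = g \<otimes> k \<otimes> inv g)"
  proof (intro bex_cong refl)
    fix k assume "k \<in> K"
    then show "n \<otimes> g = g \<otimes> k \<longleftrightarrow> n = g \<otimes> k \<otimes> inv g"
      using inv_solve_right[of n "g \<otimes> k" g] sub g n by auto
  qed
  finally show ?thesis by (auto simp: conj_set_image)
qed

lemma generate_set_mult_le_iff:
  assumes U: "subgroup U G" and H: "subgroup H G" and n: "n \<in> carrier G"
  shows "generate G {n} <#> U \<subseteq> H \<longleftrightarrow> n \<in> H \<and> U \<subseteq> H"
proof
  have Uc: "U \<subseteq> carrier G" using U by (rule subgroup.subset)
  assume le: "generate G {n} <#> U \<subseteq> H"
  have "n \<otimes> \<one> \<in> generate G {n} <#> U"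
    using generate.incl[of n "{n}" G] subgroup.one_closed[OF U] by (force simp: set_mult_def)
  moreover have "\<one> \<otimes> u \<in> generate G {n} <#> U" if "u \<in> U" for u
    using generate.one[of G "{n}"] that by (force simp: set_mult_def)
  ultimately show "n \<in> H \<and> U \<subseteq> H" using le n Uc by (metis l_one r_one subsetD subsetI)
next
  assume "n \<in> H \<and> U \<subseteq> H"
  moreover from this have "generate G {n} \<subseteq> H" using generate_subgroup_incl[OF _ H] by simp
  ultimately show "generate G {n} <#> U \<subseteq> H"
    using subgroup.m_closed[OF H] by (auto simp: set_mult_def)
qed

end

context admissible_family
begin

text \<open>Any strictly monotone function on the lattice that is constant on orbits would serve to order the
  pairs; counting the elements below is one that needs no choice.\<close>

definition height :: "'l \<Rightarrow> nat" where "height l = card {k. k \<le> l}"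

definition rank :: "'g set \<times> 'l \<Rightarrow> nat" where "rank p = card (fst p) + height (snd p)"

lemma act_le_iff:
  assumes g: "g \<in> carrier G"
  shows "act g k \<le> act g l \<longleftrightarrow> k \<le> l"
proof
  have inv: "act (inv g) (act g k) = k" for k
    using composition_rule[of k "inv g" g] g id_eq_one by (metis UNIV_I inv_closed l_inv restrict_apply')
  assume "act g k \<le> act g l"
  then have "act (inv g) (act g k) \<le> act (inv g) (act g l)"
    using act_mono[of "inv g"] g by (simp add: monoD)
  then show "k \<le> l" by (simp add: inv)
next
  show "k \<le> l \<Longrightarrow> act g k \<le> act g l" using act_mono[OF g] by (rule monoD)
qed

lemma height_act: assumes g: "g \<in> carrier G" shows "height (act g l) = height l"
proof -
  have "{k. k \<le> act g l} = act g ` {k. k \<le> l}"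
  proof (intro equalityI subsetI)
    fix k assume k: "k \<in> {k. k \<le> act g l}"
    obtain j where "k = act g j" using surj_prop[OF g] by (metis UNIV_I imageE)
    then show "k \<in> act g ` {k. k \<le> l}" using k act_le_iff[OF g] by simp
  qed (auto simp: act_le_iff[OF g])
  moreover have "inj_on (act g) {k. k \<le> l}" using inj_prop[OF g] by (rule inj_on_subset) simp
  ultimately show ?thesis by (simp add: height_def card_image)
qed

lemma height_mono: "k \<le> l \<Longrightarrow> height k \<le> height l"
  unfolding height_def by (intro card_mono) auto

lemma height_eq_imp_eq:
  assumes kl: "k \<le> l" "height l \<le> height k"
  shows "k = l"
proof -
  have "{x. x \<le> k} = {x. x \<le> l}"
    using kl unfolding height_def by (intro card_seteq) auto
  then show "k = l" using kl(1) by (auto intro: order.antisym)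
qed

lemma pairsD:
  assumes "(K, s) \<in> pairs G L"
  shows "subgroup K G" "s \<in> L K" "K \<subseteq> carrier G" "finite K"
proof -
  show K: "subgroup K G" "s \<in> L K" using assms by (auto simp: pairs_def)
  show "K \<subseteq> carrier G" using K(1) by (rule subgroup.subset)
  then show "finite K" using finite_carrier by (rule finite_subset)
qed

lemma finite_pairs: "finite (pairs G L)"
proof (rule finite_subset)
  show "pairs G L \<subseteq> Pow (carrier G) \<times> UNIV"
    unfolding pairs_def using subgroup.subset by blast
  show "finite (Pow (carrier G) \<times> (UNIV :: 'l set))" using finite_carrier by simp
qed

lemma pair_act_apply: "(K, s) \<in> pairs G L \<Longrightarrow> pair_act G act L g (K, s) = (conj_set G g K, act g s)"
  by (simp add: pair_act_def)

lemma rank_pair_act: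
  assumes "p \<in> pairs G L" "g \<in> carrier G"
  shows "rank (pair_act G act L g p) = rank p"
  using assms pairsD by (cases p) (simp add: rank_def pair_act_apply card_conj_set height_act)

text \<open>The rank is strictly monotone for the componentwise order on pairs. Together with its invariance
  this replaces arguments that iterate a group element: a pair which lies below one of its own
  translates is equal to it.\<close>

lemma rank_le_imp_eq:
  assumes "finite K" "U \<subseteq> K" "t \<le> s"
    and "rank (K, s) \<le> rank (U, t)"
  shows "U = K \<and> t = s"
proof -
  note c = card_mono[OF assms(1,2)] and h = height_mono[OF assms(3)]
  have "card K \<le> card U" "height s \<le> height t"
    using assms(4) c h by (simp_all add: rank_def)
  then show ?thesis using card_seteq[OF assms(1,2)] height_eq_imp_eq[OF assms(3)] by blast
qed

text \<open>The condition on \<open>g\<close> depends only on the coset \<open>gK\<close>, since \<open>K\<close> normalizes itself and fixes \<open>s\<close>.\<close>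

lemma marked_coset_iff:
  assumes q: "(K, s) \<in> pairs G L" and g: "g \<in> carrier G"
  shows "g <# K \<in> marked_cosets G act (U, t) (K, s) \<longleftrightarrow> U \<subseteq> conj_set G g K \<and> t \<le> act g s"
proof
  note K = pairsD[OF q]
  assume "g <# K \<in> marked_cosets G act (U, t) (K, s)"
  then obtain h where h: "h \<in> carrier G" "g <# K = h <# K" "U \<subseteq> conj_set G h K" "t \<le> act h s"
    by (auto simp: marked_cosets_def)
  then have "g \<in> h <# K" using lcos_self[OF g K(1)] by simp
  then obtain k where k: "k \<in> K" "g = h \<otimes> k" by (auto simp: l_coset_def)
  have kc: "k \<in> carrier G" using k(1) K(3) by blast
  have "conj_set G g K = conj_set G h K"
    using k h(1) kc K by (simp add: conj_set_mult conj_set_self)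
  moreover have "act g s = act h s"
    using k h(1) kc K L_fixed[OF K(1) k(1) K(2)] composition_rule[of s h k] by simp
  ultimately show "U \<subseteq> conj_set G g K \<and> t \<le> act g s" using h by simp
next
  show "U \<subseteq> conj_set G g K \<and> t \<le> act g s \<Longrightarrow> g <# K \<in> marked_cosets G act (U, t) (K, s)"
    using g by (auto simp: marked_cosets_def)
qed

lemma marked_cosetE:
  assumes "C \<in> marked_cosets G act p (K, s)"
  obtains g where "g \<in> carrier G" "C = g <# K"
  using assms by (cases p) (auto simp: marked_cosets_def)

lemma finite_marked_cosets:
  assumes "q \<in> pairs G L"
  shows "finite (marked_cosets G act p q)"
proof -
  obtain K s where q: "q = (K, s)" by (cases q)
  have "marked_cosets G act p q \<subseteq> (\<lambda>g. g <# K) ` carrier G"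
  proof
    fix C assume "C \<in> marked_cosets G act p q"
    then show "C \<in> (\<lambda>g. g <# K) ` carrier G" unfolding q by (rule marked_cosetE) simp
  qed
  then show ?thesis using finite_carrier by (simp add: finite_subset)
qed

lemma translate_marked_coset:
  assumes p: "p \<in> pairs G L" and q: "q \<in> pairs G L" and g: "g \<in> carrier G"
    and C: "C \<in> marked_cosets G act p q"
  shows "g <# C \<in> marked_cosets G act (pair_act G act L g p) q"
proof -
  obtain U t K s where pq: "p = (U, t)" "q = (K, s)" by (cases p, cases q)
  obtain h where h: "h \<in> carrier G" "C = h <# K" using C unfolding pq by (rule marked_cosetE)
  note K = pairsD[OF q[unfolded pq]]
  have "U \<subseteq> conj_set G h K" "t \<le> act h s"
    using C marked_coset_iff[OF q[unfolded pq] h(1)] unfolding pq h(2) by auto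
  then have "conj_set G g U \<subseteq> conj_set G (g \<otimes> h) K" "act g t \<le> act (g \<otimes> h) s"
    using conj_set_mono[of U _ g] act_le_iff[OF g] composition_rule[of s g h] g h(1) K(3)
    by (simp_all add: conj_set_mult)
  then have "(g \<otimes> h) <# K \<in> marked_cosets G act (pair_act G act L g p) q"
    using marked_coset_iff[OF q[unfolded pq], of "g \<otimes> h"] g h(1) p pq by (simp add: pair_act_apply)
  then show ?thesis using h g K(3) by (simp add: lcos_m_assoc)
qed

lemma marked_coset_subset_carrier:
  assumes "q \<in> pairs G L" "C \<in> marked_cosets G act p q"
  shows "C \<subseteq> carrier G"
proof -
  obtain K s where q: "q = (K, s)" by (cases q)
  obtain h where "h \<in> carrier G" "C = h <# K" using assms(2) unfolding q by (rule marked_cosetE)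
  then show ?thesis using pairsD(3)[OF assms(1)[unfolded q]] l_coset_subset_G by simp
qed

lemma l_coset_inv_cancel:
  assumes "C \<subseteq> carrier G" "g \<in> carrier G"
  shows "inv g <# (g <# C) = C" "g <# (inv g <# C) = C"
  using assms by (simp_all add: lcos_m_assoc lcos_mult_one)

lemma mark_pair_act:
  assumes p: "p \<in> pairs G L" and q: "q \<in> pairs G L" and g: "g \<in> carrier G"
  shows "mark G act (pair_act G act L g p) q = mark G act p q"
proof -
  interpret P: group_action G "pairs G L" "pair_act G act L" by (rule pair_group_action)
  have gp: "pair_act G act L g p \<in> pairs G L" using P.element_image[OF g p] by simp
  have ret: "pair_act G act L (inv g) (pair_act G act L g p) = p"
    using P.orbit_sym_aux[OF g p refl] .
  have "bij_betw (\<lambda>C. g <# C) (marked_cosets G act p q)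
    (marked_cosets G act (pair_act G act L g p) q)"
  proof (rule bij_betw_byWitness[where f' = "(\<lambda>C. inv g <# C)"])
    show "\<forall>C\<in>marked_cosets G act p q. inv g <# (g <# C) = C"
      "\<forall>C\<in>marked_cosets G act (pair_act G act L g p) q. g <# (inv g <# C) = C"
      using l_coset_inv_cancel[OF marked_coset_subset_carrier[OF q] g] by simp_all
    show "(\<lambda>C. g <# C) ` marked_cosets G act p q \<subseteq> marked_cosets G act (pair_act G act L g p) q"
      using translate_marked_coset[OF p q g] by auto
    show "(\<lambda>C. inv g <# C) ` marked_cosets G act (pair_act G act L g p) q \<subseteq> marked_cosets G act p q"
      using translate_marked_coset[OF gp q, of "inv g"] g ret by auto
  qed
  then show ?thesis unfolding mark_eq_card by (rule bij_betw_same_card[symmetric])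
qed

text \<open>Marks depend on the first pair only up to conjugation, so that the components at a pair and at its
  orbit representative coincide.\<close>

lemma mark_rep:
  assumes "orbit_reps G act L R" "p \<in> pairs G L" "q \<in> pairs G L"
  shows "mark G act (rep G act L R p) q = mark G act p q"
proof -
  obtain g where "g \<in> carrier G" "rep G act L R p = pair_act G act L g p"
    using rep_in_orbit(2)[OF assms(1,2)] unfolding orbit_def by blast
  then show ?thesis using mark_pair_act[OF assms(2,3)] by metis
qed

lemma rank_rep:
  assumes "orbit_reps G act L R" "p \<in> pairs G L"
  shows "rank (rep G act L R p) = rank p"
proof -
  obtain g where "g \<in> carrier G" "rep G act L R p = pair_act G act L g p"
    using rep_in_orbit(2)[OF assms] unfolding orbit_def by blast
  then show ?thesis using rank_pair_act[OF assms(2)] by metis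
qed

lemma subgroup_pair_stab: "p \<in> pairs G L \<Longrightarrow> subgroup (pair_stab G act L p) G"
  unfolding pair_stab_def by (rule group_action.stabilizer_subgroup[OF pair_group_action])

lemma subgroup_le_pair_stab:
  assumes "(U, t) \<in> pairs G L"
  shows "U \<subseteq> pair_stab G act L (U, t)"
proof
  note U = pairsD[OF assms]
  fix u assume u: "u \<in> U"
  show "u \<in> pair_stab G act L (U, t)"
    unfolding pair_stab_iff[OF assms]
    using subgroup.mem_carrier[OF U(1) u] conj_set_self[OF U(1) u] L_fixed[OF U(1) u U(2)] by simp
qed

lemma stab_action_on_marked_cosets:
  assumes p: "p \<in> pairs G L" and q: "q \<in> pairs G L"
  shows "group_action (G\<lparr>carrier := pair_stab G act L p\<rparr>) (marked_cosets G act p q)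
    (\<lambda>n. \<lambda>C\<in>marked_cosets G act p q. n <# C)"
proof -
  let ?N = "pair_stab G act L p" and ?E = "marked_cosets G act p q"
  let ?f = "\<lambda>n. \<lambda>C\<in>?E. n <# C"
  have N: "subgroup ?N G" using p by (rule subgroup_pair_stab)
  have nc: "n \<in> carrier G" if "n \<in> ?N" for n using N that by (rule subgroup.mem_carrier)
  have cl: "n <# C \<in> ?E" if "n \<in> ?N" "C \<in> ?E" for n C
    using translate_marked_coset[OF p q nc[OF that(1)] that(2)] that(1)
    by (simp add: pair_stab_def stabilizer_def)
  note sub = marked_coset_subset_carrier[OF q]
  have "bij_betw (?f n) ?E ?E" if n: "n \<in> ?N" for n
  proof (rule bij_betw_byWitness[where f' = "?f (inv n)"])
    have n': "inv n \<in> ?N" using N n by (rule subgroup.m_inv_closed)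
    show "\<forall>C\<in>?E. ?f (inv n) (?f n C) = C" "\<forall>C\<in>?E. ?f n (?f (inv n) C) = C"
      using cl n n' l_coset_inv_cancel[OF sub nc[OF n]] by simp_all
    show "?f n ` ?E \<subseteq> ?E" "?f (inv n) ` ?E \<subseteq> ?E" using cl n n' by auto
  qed
  then have "?f n \<in> Bij ?E" if "n \<in> ?N" for n
    using that by (simp add: Bij_def)
  moreover have "?f (m \<otimes> n) = compose ?E (?f m) (?f n)" if "m \<in> ?N" "n \<in> ?N" for m n
    unfolding compose_def
  proof (rule restrict_ext)
    fix C assume "C \<in> ?E"
    then show "(m \<otimes> n) <# C = ?f m (?f n C)" using that cl nc sub by (simp add: lcos_m_assoc)
  qed
  ultimately have "?f \<in> hom (G\<lparr>carrier := ?N\<rparr>) (BijGroup ?E)"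
    unfolding hom_def by (simp add: BijGroup_def)
  then show ?thesis
    using subgroup_imp_group[OF N] group_BijGroup
    unfolding group_action_def group_hom_def group_hom_axioms_def by blast
qed

text \<open>The element \<open>t'\<close> generates the elements above \<open>t\<close> not just inside \<open>L V\<close> but inside every \<open>L H\<close>
  with \<open>V \<subseteq> H\<close>: restricting \<open>s\<close> from \<open>H\<close> to \<open>V\<close> gives an element of \<open>L V\<close> that is still above
  \<open>t\<close>, because \<open>t \<le> Sup_fin (L U) \<le> Sup_fin (L V)\<close>.\<close>

lemma least_above:
  assumes V: "subgroup V G" and U: "subgroup U G" "U \<subseteq> V" "t \<in> L U"
  defines "t' \<equiv> Inf_fin {s \<in> L V. t \<le> s}"
  shows "t \<le> t'" and "subgroup H G \<Longrightarrow> V \<subseteq> H \<Longrightarrow> s \<in> L H \<Longrightarrow> t' \<le> s \<longleftrightarrow> t \<le> s"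
proof -
  have closed: "sup x y \<in> L V" "inf x y \<in> L V" if "x \<in> L V" "y \<in> L V" for x y
    using L_sublattice[OF V] that by (auto simp: sublattice_def)
  have "t \<le> Sup_fin (L U)" using U(3) by (simp add: Sup_fin.coboundedI)
  also have "\<dots> \<le> Sup_fin (L V)" using L_Sup_mono[OF V U(1,2)] .
  finally have le: "t \<le> Sup_fin (L V)" .
  then have "Sup_fin (L V) \<in> {s \<in> L V. t \<le> s}"
    using Sup_fin_in[OF L_nonempty[OF V] closed(1)] by blast
  then have "t' \<in> {s \<in> L V. t \<le> s}"
    unfolding t'_def using closed(2) by (intro Inf_fin_in) auto
  then show t': "t \<le> t'" by blast
  show "t' \<le> s \<longleftrightarrow> t \<le> s" if H: "subgroup H G" "V \<subseteq> H" "s \<in> L H"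
  proof
    assume "t \<le> s"
    then have "inf s (Sup_fin (L V)) \<in> {s \<in> L V. t \<le> s}"
      using L_restrict[OF H(1) V H(2,3)] le by simp
    then have "t' \<le> inf s (Sup_fin (L V))" unfolding t'_def by (intro Inf_fin.coboundedI) auto
    then show "t' \<le> s" by simp
  next
    show "t' \<le> s \<Longrightarrow> t \<le> s" using t' by (rule order.trans)
  qed
qed

text \<open>This is where the pair \<open>(\<langle>n\<rangle>U, t')\<close> comes from: a coset \<open>gK\<close> marked by \<open>(U, t)\<close> is fixed by \<open>n\<close>
  iff \<open>n\<close> lies in the conjugate of \<open>K\<close> by \<open>g\<close>, iff this conjugate contains \<open>\<langle>n\<rangle>U\<close>; and then being
  above \<open>t\<close> is the same as being above the least element of \<open>L (\<langle>n\<rangle>U)\<close> above \<open>t\<close>.\<close>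

lemma stab_fixed_marked_cosets:
  assumes p: "p \<in> pairs G L" and q: "q \<in> pairs G L" and n: "n \<in> pair_stab G act L p"
  shows "invariants (marked_cosets G act p q) (\<lambda>n. \<lambda>C\<in>marked_cosets G act p q. n <# C) n
    = marked_cosets G act (gamma_pair G L p n) q"
proof -
  obtain U t K s where pq: "p = (U, t)" "q = (K, s)" by (cases p, cases q)
  define V where "V = generate G {n} <#> U"
  define t' where "t' = Inf_fin {s \<in> L V. t \<le> s}"
  note U = pairsD[OF p[unfolded pq]] and K = pairsD[OF q[unfolded pq]]
  note iff = marked_coset_iff[OF q[unfolded pq]]
  have nc: "n \<in> carrier G" using n subgroup.mem_carrier[OF subgroup_pair_stab[OF p]] by blast
  have V: "subgroup V G" unfolding V_def using gamma_pair_subgroup p n unfolding pq by blast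
  have gp: "gamma_pair G L p n = (V, t')" by (simp add: pq gamma_pair_def V_def t'_def Let_def)
  have UV: "U \<subseteq> V" using generate_set_mult_le_iff[OF U(1) V nc] by (simp add: V_def)
  have "C \<in> marked_cosets G act p q \<and> n <# C = C \<longleftrightarrow> C \<in> marked_cosets G act (V, t') q"
    if C: "C = g <# K" and g: "g \<in> carrier G" for C g
  proof -
    have gK: "subgroup (conj_set G g K) G" using K(1) g by (rule conj_set_subgroup)
    have "act g s \<in> L (conj_set G g K)" using L_conj[OF K(1) g] K(2) by simp
    then have "t' \<le> act g s \<longleftrightarrow> t \<le> act g s" if "V \<subseteq> conj_set G g K"
      using least_above(2)[OF V U(1) UV U(2) gK that] by (simp add: t'_def)
    moreover have "V \<subseteq> conj_set G g K \<longleftrightarrow> n \<in> conj_set G g K \<and> U \<subseteq> conj_set G g K"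
      unfolding V_def using generate_set_mult_le_iff[OF U(1) gK nc] .
    ultimately show ?thesis
      unfolding pq C iff[OF g] l_coset_fixed_iff[OF K(1) g nc] by blast
  qed
  moreover have "\<exists>g\<in>carrier G. C = g <# K" if "C \<in> marked_cosets G act r q" for C r
    using that unfolding pq by (rule marked_cosetE) blast
  ultimately have "C \<in> marked_cosets G act p q \<and> n <# C = C \<longleftrightarrow> C \<in> marked_cosets G act (V, t') q" for C
    by metis
  then show ?thesis unfolding gp invariants_def by auto
qed


section \<open>Congruences for the image of the lattice Burnside ring\<close>

lemma gamma_pair_fixed:
  assumes p: "(U, t) \<in> pairs G L" and u: "u \<in> U"
  shows "gamma_pair G L (U, t) u = (U, t)"
proof -
  note U = pairsD[OF p]
  have "generate G {u} <#> U \<subseteq> U" using generate_set_mult_le_iff[OF U(1,1), of u] U(3) u by auto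
  moreover have "U \<subseteq> generate G {u} <#> U"
    using generate.one[of G "{u}"] U(3) by (force simp: set_mult_def)
  ultimately have V: "generate G {u} <#> U = U" by simp
  have "Inf_fin {s \<in> L U. t \<le> s} = t"
  proof (rule order.antisym)
    show "Inf_fin {s \<in> L U. t \<le> s} \<le> t" using U(2) by (intro Inf_fin.coboundedI) auto
    show "t \<le> Inf_fin {s \<in> L U. t \<le> s}" using least_above(1)[OF U(1,1) _ U(2)] by simp
  qed
  then show ?thesis by (simp add: gamma_pair_def V)
qed

lemma rank_gamma_pair:
  assumes p: "(U, t) \<in> pairs G L" and n: "n \<in> pair_stab G act L (U, t)" and "n \<notin> U"
  shows "rank (U, t) < rank (gamma_pair G L (U, t) n)"
proof -
  define V where "V = generate G {n} <#> U"
  note U = pairsD[OF p]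
  have nc: "n \<in> carrier G" using n subgroup.mem_carrier[OF subgroup_pair_stab[OF p]] by blast
  have V: "subgroup V G" unfolding V_def using gamma_pair_subgroup[OF p n] .
  have "n \<in> V \<and> U \<subseteq> V" using generate_set_mult_le_iff[OF U(1) V nc] by (simp add: V_def)
  then have n: "n \<in> V" and UV: "U \<subseteq> V" by simp_all
  have gp: "gamma_pair G L (U, t) n = (V, Inf_fin {s \<in> L V. t \<le> s})"
    by (simp add: gamma_pair_def V_def Let_def)
  have "finite V" using finite_subset[OF subgroup.subset[OF V] finite_carrier] .
  moreover have "t \<le> Inf_fin {s \<in> L V. t \<le> s}"
    using least_above(1)[OF V U(1) UV U(2)] .
  ultimately show ?thesis
    using rank_le_imp_eq[OF _ UV] n \<open>n \<notin> U\<close>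
    unfolding gp by (metis not_le)
qed

text \<open>The table of marks is triangular: a nonzero mark places \<open>p\<close> below a translate of \<open>q\<close>, and equality
  is excluded because distinct representatives lie in different orbits.\<close>

lemma mark_nonzero_rank:
  assumes R: "orbit_reps G act L R" and p: "p \<in> R" and q: "q \<in> R"
    and "mark G act p q \<noteq> 0" and "p \<noteq> q"
  shows "rank p < rank q"
proof -
  interpret P: group_action G "pairs G L" "pair_act G act L" by (rule pair_group_action)
  obtain U t K s where pq: "p = (U, t)" "q = (K, s)" by (cases p, cases q)
  have pP: "p \<in> pairs G L" and qP: "q \<in> pairs G L" using R p q by (auto simp: orbit_reps_def)
  obtain C where C: "C \<in> marked_cosets G act p q"
    using assms(4) unfolding mark_eq_card by (metis card.empty ex_in_conv)
  then obtain g where g: "g \<in> carrier G" "C = g <# K" unfolding pq by (rule marked_cosetE)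
  have le: "U \<subseteq> conj_set G g K" "t \<le> act g s"
    using C marked_coset_iff[OF qP[unfolded pq] g(1)] unfolding pq g(2) by auto
  have gq: "pair_act G act L g q = (conj_set G g K, act g s)"
    using qP unfolding pq by (rule pair_act_apply)
  have "pair_act G act L g q \<in> pairs G L" using P.element_image[OF g(1) qP] by simp
  then have fin: "finite (conj_set G g K)" unfolding gq by (rule pairsD)
  have r: "rank (conj_set G g K, act g s) = rank q"
    using rank_pair_act[OF qP g(1)] by (simp add: gq)
  have "p \<noteq> (conj_set G g K, act g s)"
  proof
    assume "p = (conj_set G g K, act g s)"
    then have "p = pair_act G act L g q" by (simp add: gq)
    then have "p \<in> orbit G (pair_act G act L) q" using g(1) by (auto simp: orbit_def)
    then show False
      using R p q qP P.orbit_refl[OF qP] \<open>p \<noteq> q\<close> unfolding orbit_reps_def by blast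
  qed
  then show ?thesis
    using rank_le_imp_eq[OF fin le] unfolding r unfolding pq by (metis not_le)
qed

text \<open>A pair below one of its own translates is equal to it, so the cosets counted by a diagonal mark
  are those of elements of the stabilizer \<open>N\<close>, and the mark is the index of \<open>U\<close> in \<open>N\<close>.\<close>

lemma mark_self:
  assumes p: "(U, t) \<in> pairs G L"
  shows "mark G act (U, t) (U, t) * card U = card (pair_stab G act L (U, t))"
proof -
  let ?N = "pair_stab G act L (U, t)"
  note U = pairsD[OF p]
  have N: "subgroup ?N G" using p by (rule subgroup_pair_stab)
  have stab: "U \<subseteq> conj_set G g U \<and> t \<le> act g t \<longleftrightarrow> g \<in> ?N" if g: "g \<in> carrier G" for g
  proof
    assume le: "U \<subseteq> conj_set G g U \<and> t \<le> act g t"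
    have "finite (conj_set G g U)" using finite_subset[OF conj_set_subset[OF g U(3)] finite_carrier] .
    moreover have "rank (conj_set G g U, act g t) = rank (U, t)"
      using rank_pair_act[OF p g] by (simp add: pair_act_apply[OF p])
    ultimately have "U = conj_set G g U \<and> t = act g t" using le rank_le_imp_eq[of "conj_set G g U" U t "act g t"] by linarith
    then show "g \<in> ?N" using g by (simp add: pair_stab_iff[OF p])
  next
    assume "g \<in> ?N"
    then show "U \<subseteq> conj_set G g U \<and> t \<le> act g t" by (simp add: pair_stab_iff[OF p])
  qed
  interpret N: group "G\<lparr>carrier := ?N\<rparr>" using N by (rule subgroup_imp_group)
  have "marked_cosets G act (U, t) (U, t) = (\<lambda>g. g <# U) ` ?N"
    using stab subgroup.mem_carrier[OF N] by (auto simp: marked_cosets_def)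
  also have "\<dots> = lcosets\<^bsub>G\<lparr>carrier := ?N\<rparr>\<^esub> U" by (auto simp: LCOSETS_def)
  finally have eq: "marked_cosets G act (U, t) (U, t) = lcosets\<^bsub>G\<lparr>carrier := ?N\<rparr>\<^esub> U" .
  have "finite ?N" using finite_subset[OF subgroup.subset[OF N] finite_carrier] .
  then show ?thesis
    using N.l_lagrange[OF _ subgroup_incl[OF U(1) N subgroup_le_pair_stab[OF p]]]
    by (simp add: mark_eq_card eq order_def)
qed

text \<open>The congruences are modulo the order of the stabilizer \<open>N\<close> of \<open>(U, t)\<close> and sum over \<open>N\<close>. The
  summands are constant on cosets of \<open>U\<close>, so this is the usual congruence modulo the order of
  \<open>N/U\<close> with both sides multiplied by the order of \<open>U\<close>, and it spares the quotient group.\<close>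

definition stab_congruences :: "('g set \<times> 'l) set \<Rightarrow> ('g set \<times> 'l \<Rightarrow> int) \<Rightarrow> bool" where
  "stab_congruences R y \<longleftrightarrow> (\<forall>p\<in>R. int (card (pair_stab G act L p)) dvd
     (\<Sum>n\<in>pair_stab G act L p. y (rep G act L R (gamma_pair G L p n))))"

lemma mark_rep_gamma_pair:
  assumes R: "orbit_reps G act L R" and p: "p \<in> pairs G L" and q: "q \<in> pairs G L"
    and n: "n \<in> pair_stab G act L p"
  shows "mark G act (rep G act L R (gamma_pair G L p n)) q =
    card (invariants (marked_cosets G act p q) (\<lambda>n. \<lambda>C\<in>marked_cosets G act p q. n <# C) n)"
proof -
  have "gamma_pair G L p n \<in> pairs G L" using gamma_pair_in_pairs p n by (cases p) simp
  then show ?thesis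
    unfolding stab_fixed_marked_cosets[OF p q n] mark_eq_card[symmetric] using mark_rep[OF R _ q] by simp
qed

text \<open>The summands are fixed point counts for the stabilizer acting on the marked cosets, so by
  Burnside's lemma their sum is the number of orbits times the order of the stabilizer.\<close>

lemma stab_congruences_mark:
  assumes R: "orbit_reps G act L R" and q: "q \<in> R"
  shows "stab_congruences R (\<lambda>p. int (mark G act p q))"
  unfolding stab_congruences_def
proof
  fix p assume "p \<in> R"
  then have p: "p \<in> pairs G L" and q: "q \<in> pairs G L" using R q by (auto simp: orbit_reps_def)
  let ?N = "pair_stab G act L p"
  let ?E = "marked_cosets G act p q" and ?f = "\<lambda>n. \<lambda>C\<in>marked_cosets G act p q. n <# C"
  interpret N: group_action "G\<lparr>carrier := ?N\<rparr>" ?E ?f using p q by (rule stab_action_on_marked_cosets)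
  have "finite ?N" using finite_subset[OF subgroup.subset[OF subgroup_pair_stab[OF p]] finite_carrier] .
  then have "(\<Sum>n\<in>?N. card (invariants ?E ?f n)) = card (orbits (G\<lparr>carrier := ?N\<rparr>) ?E ?f) * card ?N"
    using N.burnside[OF _ finite_marked_cosets[OF q]] by (simp add: order_def)
  then have "(\<Sum>n\<in>?N. mark G act (rep G act L R (gamma_pair G L p n)) q) =
      card (orbits (G\<lparr>carrier := ?N\<rparr>) ?E ?f) * card ?N"
    using mark_rep_gamma_pair[OF R p q] by simp
  then show "int (card ?N) dvd (\<Sum>n\<in>?N. int (mark G act (rep G act L R (gamma_pair G L p n)) q))"
    unfolding of_nat_sum[symmetric] by simp
qed

lemma stab_congruences_diff:
  assumes "stab_congruences R y" "stab_congruences R z"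
  shows "stab_congruences R (\<lambda>p. y p - a * z p)"
  using assms unfolding stab_congruences_def
  by (simp add: sum_subtractf sum_distrib_left[symmetric])

text \<open>For \<open>n \<in> U\<close> the pair attached to \<open>n\<close> is \<open>(U, t)\<close> itself, and for all other \<open>n\<close> it has larger
  rank, where \<open>y\<close> vanishes. The congruence at \<open>(U, t)\<close> thus only involves \<open>y (U, t)\<close>, taken as
  many times as \<open>U\<close> has elements.\<close>

lemma top_support_divisible:
  assumes R: "orbit_reps G act L R" and y: "stab_congruences R y" and q: "q \<in> R"
    and top: "\<And>p. p \<in> R \<Longrightarrow> rank q < rank p \<Longrightarrow> y p = 0"
  shows "int (mark G act q q) dvd y q"
proof -
  obtain U t where qU: "q = (U, t)" by (cases q)
  let ?N = "pair_stab G act L q" and ?r = "\<lambda>n. rep G act L R (gamma_pair G L q n)"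
  have qP: "q \<in> pairs G L" using R q by (auto simp: orbit_reps_def)
  note U = pairsD[OF qP[unfolded qU]]
  have sub: "U \<subseteq> ?N" using subgroup_le_pair_stab qP unfolding qU .
  have N: "subgroup ?N G" using qP by (rule subgroup_pair_stab)
  have fin: "finite ?N" using finite_subset[OF subgroup.subset[OF N] finite_carrier] .
  have "y (?r n) = (if n \<in> U then y q else 0)" if n: "n \<in> ?N" for n
  proof (cases "n \<in> U")
    case True
    then show ?thesis using gamma_pair_fixed qP rep_of_rep[OF R q] unfolding qU by simp
  next
    case False
    have gP: "gamma_pair G L q n \<in> pairs G L" using gamma_pair_in_pairs qP n unfolding qU .
    have "rank q < rank (?r n)"
      using rank_gamma_pair qP n False unfolding rank_rep[OF R gP] unfolding qU .
    then show ?thesis using top rep_in_orbit(1)[OF R gP] False by simp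
  qed
  then have "(\<Sum>n\<in>?N. y (?r n)) = (\<Sum>n\<in>?N. if n \<in> U then y q else 0)" by (intro sum.cong) auto
  also have "\<dots> = y q * int (card U)"
    using fin sub by (simp add: sum.If_cases Int_absorb1)
  finally have sum: "(\<Sum>n\<in>?N. y (?r n)) = y q * int (card U)" .
  have "int (card ?N) dvd (\<Sum>n\<in>?N. y (?r n))"
    using y q unfolding stab_congruences_def by (rule bspec)
  then have "int (card ?N) dvd y q * int (card U)" unfolding sum .
  moreover have m: "mark G act q q * card U = card ?N" using mark_self qP unfolding qU .
  moreover have "card U > 0" using U(4) subgroup.one_closed[OF U(1)] by (auto simp: card_gt_0_iff)
  ultimately show "int (mark G act q q) dvd y q"
    unfolding m[symmetric] of_nat_mult dvd_mult_cancel_right by simp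
qed

lemma finite_reps: "orbit_reps G act L R \<Longrightarrow> finite R"
  by (rule finite_subset[OF _ finite_pairs]) (simp add: orbit_reps_def)

text \<open>Gaussian elimination along the triangular table of marks, starting from the representatives of
  largest rank. The set \<open>S\<close> is closed downwards for the rank, so subtracting a multiple of the column
  of its top element \<open>x\<close> keeps the support inside \<open>S\<close> and removes \<open>x\<close> from it.\<close>

lemma mark_combination_of_supported:
  assumes R: "orbit_reps G act L R" and fin: "finite S" and "S \<subseteq> R"
    and "\<And>p q. p \<in> R \<Longrightarrow> q \<in> S \<Longrightarrow> rank p < rank q \<Longrightarrow> p \<in> S"
    and "\<And>p. p \<in> R \<Longrightarrow> p \<notin> S \<Longrightarrow> y p = 0" and "stab_congruences R y"
  shows "\<exists>c. \<forall>p\<in>R. y p = (\<Sum>q\<in>R. c q * int (mark G act p q))"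
  using fin assms(3-)
proof (induction S arbitrary: y rule: finite_ranking_induct[where f = rank])
  case empty
  then show ?case by (intro exI[of _ "\<lambda>_. 0"]) simp
next
  case (insert x S)
  note sub = insert.prems(1) and closed = insert.prems(2) and supp = insert.prems(3)
    and cong = insert.prems(4)
  have x: "x \<in> R" using sub by simp
  have above: "y p = 0" if "p \<in> R" "rank x < rank p" for p
    using supp[OF that(1)] insert.hyps(2)[of p] that(2) by auto
  define a where "a = y x div int (mark G act x x)"
  have a: "y x = a * int (mark G act x x)"
    using top_support_divisible[OF R cong x above] by (simp add: a_def)
  let ?z = "\<lambda>p. y p - a * int (mark G act p x)"
  have zero: "?z p = 0" if p: "p \<in> R" "p \<notin> S" for p
  proof (cases "p = x")
    case False
    have "mark G act p x = 0"
      using mark_nonzero_rank[OF R p(1) x _ False] closed[OF p(1), of x] p(2) False by auto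
    then show ?thesis using supp[OF p(1)] p(2) False by simp
  qed (simp add: a)
  have down: "p \<in> S" if "p \<in> R" "q \<in> S" "rank p < rank q" for p q
    using closed[OF that(1), of q] insert.hyps(2)[OF that(2)] that by auto
  have "\<exists>c. \<forall>p\<in>R. ?z p = (\<Sum>q\<in>R. c q * int (mark G act p q))"
  proof (rule insert.IH)
    show "S \<subseteq> R" using sub by simp
    show "stab_congruences R ?z"
      using stab_congruences_diff[OF cong stab_congruences_mark[OF R x]] .
  qed (fact down zero)+
  then obtain c where c: "\<forall>p\<in>R. ?z p = (\<Sum>q\<in>R. c q * int (mark G act p q))" ..
  have "y p = (\<Sum>q\<in>R. (c q + (if q = x then a else 0)) * int (mark G act p q))" if "p \<in> R" for p
  proof -
    have "(\<Sum>q\<in>R. (if q = x then a else 0) * int (mark G act p q)) =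
        (\<Sum>q\<in>R. if q = x then a * int (mark G act p x) else 0)"
      by (intro sum.cong) auto
    then show ?thesis using bspec[OF c that] finite_reps[OF R] x
      by (simp add: distrib_right sum.distrib)
  qed
  then show ?case by (intro exI ballI)
qed

text \<open>The analogue for lattice Burnside rings of Dress's description of the image of the Burnside ring
  in its ghost ring.\<close>

theorem mark_combination_iff_congruences:
  assumes R: "orbit_reps G act L R"
  shows "(\<exists>c. \<forall>p\<in>R. y p = (\<Sum>q\<in>R. c q * int (mark G act p q))) \<longleftrightarrow> stab_congruences R y"
proof
  assume "\<exists>c. \<forall>p\<in>R. y p = (\<Sum>q\<in>R. c q * int (mark G act p q))"
  then obtain c where c: "\<forall>p\<in>R. y p = (\<Sum>q\<in>R. c q * int (mark G act p q))" ..
  show "stab_congruences R y"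
    unfolding stab_congruences_def
  proof
    fix p assume pR: "p \<in> R"
    then have p: "p \<in> pairs G L" using R by (auto simp: orbit_reps_def)
    let ?N = "pair_stab G act L p" and ?r = "\<lambda>n. rep G act L R (gamma_pair G L p n)"
    have r: "?r n \<in> R" if "n \<in> ?N" for n
      using gamma_pair_in_pairs p that rep_in_orbit(1)[OF R] by (cases p) simp
    have "(\<Sum>n\<in>?N. y (?r n)) = (\<Sum>n\<in>?N. \<Sum>q\<in>R. c q * int (mark G act (?r n) q))"
      using bspec[OF c r] by (rule sum.cong[OF refl])
    also have "\<dots> = (\<Sum>q\<in>R. c q * (\<Sum>n\<in>?N. int (mark G act (?r n) q)))"
      by (subst sum.swap) (simp add: sum_distrib_left)
    finally have sum: "(\<Sum>n\<in>?N. y (?r n)) = (\<Sum>q\<in>R. c q * (\<Sum>n\<in>?N. int (mark G act (?r n) q)))" .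
    show "int (card ?N) dvd (\<Sum>n\<in>?N. y (?r n))"
      unfolding sum
    proof (rule dvd_sum)
      fix q assume "q \<in> R"
      then have "int (card ?N) dvd (\<Sum>n\<in>?N. int (mark G act (?r n) q))"
        using bspec[OF stab_congruences_mark[OF R, unfolded stab_congruences_def] pR] by simp
      then show "int (card ?N) dvd c q * (\<Sum>n\<in>?N. int (mark G act (?r n) q))" by (rule dvd_mult)
    qed
  qed
next
  show "stab_congruences R y \<Longrightarrow> \<exists>c. \<forall>p\<in>R. y p = (\<Sum>q\<in>R. c q * int (mark G act p q))"
    by (rule mark_combination_of_supported[OF R finite_reps[OF R] order_refl]) simp_all
qed

text \<open>Since there are finitely many representatives, integer coefficients may be given by an arbitrary
  function instead of one with finite support.\<close>

lemma in_image_alpha_phi_iff: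
  assumes R: "orbit_reps G act L R" and y: "y \<in> R \<rightarrow>\<^sub>E UNIV"
  shows "y \<in> alpha_phi G act R ` carrier (lattice_burnside_ring G act L R) \<longleftrightarrow>
    (\<exists>c. \<forall>p\<in>R. y p = (\<Sum>q\<in>R. c q * int (mark G act p q)))"
proof -
  have fin: "finite R" using R by (rule finite_reps)
  have alpha: "alpha_phi G act R c = (\<lambda>p\<in>R. \<Sum>q\<in>R. Poly_Mapping.lookup c q * int (mark G act p q))"
    if "Poly_Mapping.keys c \<subseteq> R" for c
    unfolding alpha_phi_def using that fin
    by (intro restrict_ext sum.mono_neutral_left) (auto simp: in_keys_iff)
  show ?thesis
  proof
    assume "y \<in> alpha_phi G act R ` carrier (lattice_burnside_ring G act L R)"
    then obtain c where "c \<in> carrier (lattice_burnside_ring G act L R)" "y = alpha_phi G act R c"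
      by (rule imageE)
    then show "\<exists>c. \<forall>p\<in>R. y p = (\<Sum>q\<in>R. c q * int (mark G act p q))"
      by (intro exI[of _ "Poly_Mapping.lookup c"]) (simp add: alpha lattice_burnside_ring_def)
  next
    assume "\<exists>c. \<forall>p\<in>R. y p = (\<Sum>q\<in>R. c q * int (mark G act p q))"
    then obtain c where c: "\<forall>p\<in>R. y p = (\<Sum>q\<in>R. c q * int (mark G act p q))" by blast
    define d where "d = Abs_poly_mapping (\<lambda>q. if q \<in> R then c q else 0)"
    have d: "Poly_Mapping.lookup d q = (if q \<in> R then c q else 0)" for q
      unfolding d_def using fin by (subst lookup_Abs_poly_mapping) auto
    have keys: "Poly_Mapping.keys d \<subseteq> R" by (auto simp: in_keys_iff d split: if_splits)
    have "y = alpha_phi G act R d"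
    proof
      fix p
      show "y p = alpha_phi G act R d p"
        using bspec[OF c, of p] PiE_arb[OF y, of p] by (cases "p \<in> R") (simp_all add: alpha[OF keys] d)
    qed
    moreover have "d \<in> carrier (lattice_burnside_ring G act L R)"
      using keys by (simp add: lattice_burnside_ring_def)
    ultimately show "y \<in> alpha_phi G act R ` carrier (lattice_burnside_ring G act L R)" by (rule image_eqI)
  qed
qed


section \<open>Units and homomorphisms to the group of signs\<close>

text \<open>Right translations compose in the opposite order. This does no harm to the homomorphism property
  of maps into the commutative group of signs, and so the latter can be tested on the stabilizer.\<close>

lemma compose_sigma:
  assumes p: "(U, t) \<in> pairs G L"
    and g: "g \<in> pair_stab G act L (U, t)" and h: "h \<in> pair_stab G act L (U, t)"
  shows "compose (lcosets U) (sigma G U g) (sigma G U h) = sigma G U (h \<otimes> g)"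
proof
  fix C
  have hg: "h \<otimes> g \<in> pair_stab G act L (U, t)"
    using subgroup.m_closed[OF subgroup_pair_stab[OF p] h g] .
  show "compose (lcosets U) (sigma G U g) (sigma G U h) C = sigma G U (h \<otimes> g) C"
  proof (cases "C \<in> lcosets U")
    case True
    then obtain r where "r \<in> carrier G" "C = r <# U" by (auto simp: LCOSETS_def)
    then show ?thesis
      using True g h hg pairsD(1)[OF p] unfolding pair_stab_iff[OF p]
      by (simp add: compose_def sigma_lcoset m_assoc)
  qed (simp add: compose_def sigma_def)
qed

lemma gamma_hom_iff:
  fixes x :: "'g set \<times> 'l \<Rightarrow> int" and R :: "('g set \<times> 'l) set"
  assumes p: "(U, t) \<in> pairs G L"
  defines "f \<equiv> \<lambda>n. gamma G act L R x (U, t) (sigma G U n)"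
  shows "gamma G act L R x (U, t) \<in> hom (aut_group G act L (U, t)) sign_group \<longleftrightarrow>
    (\<forall>g\<in>pair_stab G act L (U, t). f g \<in> {1, - 1}) \<and>
    (\<forall>g\<in>pair_stab G act L (U, t). \<forall>h\<in>pair_stab G act L (U, t). f (g \<otimes> h) = f g * f h)"
proof -
  let ?N = "pair_stab G act L (U, t)"
  have "sigma G U g \<otimes>\<^bsub>aut_group G act L (U, t)\<^esub> sigma G U h = sigma G U (h \<otimes> g)"
    if "g \<in> ?N" "h \<in> ?N" for g h
  proof -
    have "sigma G U n \<in> Bij (lcosets U)" if n: "n \<in> ?N" for n
    proof -
      have n': "inv n \<in> ?N" using subgroup.m_inv_closed[OF subgroup_pair_stab[OF p] n] .
      have nc: "n \<in> carrier G" using n by (simp add: pair_stab_iff[OF p])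
      have one: "sigma G U \<one> C = C" if "C \<in> lcosets U" for C
        using that sigma_lcoset[OF pairsD(1)[OF p] one_closed _ conj_set_one[OF pairsD(3)[OF p]]]
        by (auto simp: LCOSETS_def)
      have cl: "sigma G U m C \<in> lcosets U" if "m \<in> ?N" "C \<in> lcosets U" for m C
        using that sigma_lcoset[OF pairsD(1)[OF p], of m] unfolding pair_stab_iff[OF p]
        by (auto simp: LCOSETS_def)
      have comp: "sigma G U m (sigma G U k C) = sigma G U (k \<otimes> m) C"
        if "m \<in> ?N" "k \<in> ?N" "C \<in> lcosets U" for m k C
        using fun_cong[OF compose_sigma[OF p that(1,2)], of C] that(3) by (simp add: compose_def)
      have "bij_betw (sigma G U n) (lcosets U) (lcosets U)"
        by (rule bij_betw_byWitness[where f' = "sigma G U (inv n)"])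
          (use n n' nc one cl comp in auto)
      then show ?thesis by (simp add: Bij_def sigma_def)
    qed
    then show ?thesis
      using that compose_sigma[OF p that] by (simp add: aut_group_def BijGroup_def)
  qed
  then show ?thesis
    unfolding hom_def f_def by (auto simp: aut_group_def sign_group_def Pi_iff mult.commute)
qed

text \<open>For one direction, the values along the stabilizer of a pair are those of a virtual permutation
  character. For the other, a homomorphism to signs has sum zero unless it is trivial, in which case
  its sum is the order of the group; either way the congruences hold.\<close>

theorem unit_in_image_iff:
  assumes R: "orbit_reps G act L R" and x: "x \<in> R \<rightarrow>\<^sub>E UNIV" "\<And>p. p \<in> R \<Longrightarrow> x p \<in> {1, - 1}"
  shows "x \<in> alpha_phi G act R ` carrier (lattice_burnside_ring G act L R) \<longleftrightarrow>
    (\<forall>(U, t)\<in>R. gamma G act L R x (U, t) \<in> hom (aut_group G act L (U, t)) sign_group)"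
proof -
  define f where "f p n = x (rep G act L R (gamma_pair G L p n))" for p n
  have RP: "p \<in> pairs G L" if "p \<in> R" for p using R that by (auto simp: orbit_reps_def)
  have rep_R: "rep G act L R (gamma_pair G L p n) \<in> R" if "p \<in> R" "n \<in> pair_stab G act L p" for p n
    using gamma_pair_in_pairs RP[OF that(1)] that(2) rep_in_orbit(1)[OF R] by (cases p) simp
  have f_unit: "f p n \<in> {1, - 1}" if "p \<in> R" "n \<in> pair_stab G act L p" for p n
    unfolding f_def using x(2) rep_R[OF that] .
  have gamma_f: "gamma G act L R x p (sigma G (fst p) n) = x p * f p n"
    if "p \<in> R" "n \<in> pair_stab G act L p" for p n
    using gamma_sigma[of "fst p" "snd p" n R x] RP[OF that(1)] that rep_of_rep[OF R that(1)]
    by (simp add: f_def)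
  have f_one: "f p \<one> = x p" if "p \<in> R" for p
    using gamma_pair_fixed[of "fst p" "snd p" \<one>] RP[OF that] pairsD(1)[of "fst p" "snd p"]
      rep_of_rep[OF R that] by (simp add: f_def subgroup.one_closed)
  have hom: "gamma G act L R x p \<in> hom (aut_group G act L p) sign_group \<longleftrightarrow>
      (\<forall>g\<in>pair_stab G act L p. \<forall>h\<in>pair_stab G act L p.
        x p * f p (g \<otimes> h) = (x p * f p g) * (x p * f p h))" if p: "p \<in> R" for p
  proof -
    have "x p * f p n \<in> {1, - 1}" if "n \<in> pair_stab G act L p" for n
      using f_unit[OF p that] x(2)[OF p] by auto
    then show ?thesis
      using gamma_hom_iff[of "fst p" "snd p" R x] RP[OF p] gamma_f[OF p]
        subgroup.m_closed[OF subgroup_pair_stab[OF RP[OF p]]] by simp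
  qed
  show ?thesis
  proof
    assume "x \<in> alpha_phi G act R ` carrier (lattice_burnside_ring G act L R)"
    then obtain c where c: "x p = (\<Sum>q\<in>R. c q * int (mark G act p q))" if "p \<in> R" for p
      using in_image_alpha_phi_iff[OF R x(1)] by blast
    have "gamma G act L R x p \<in> hom (aut_group G act L p) sign_group" if p: "p \<in> R" for p
    proof -
      let ?N = "pair_stab G act L p"
      have N: "subgroup ?N G" using subgroup_pair_stab[OF RP[OF p]] .
      interpret N: group "G\<lparr>carrier := ?N\<rparr>" using N by (rule subgroup_imp_group)
      have fin: "finite ?N" using finite_subset[OF subgroup.subset[OF N] finite_carrier] .
      have "f p n = (\<Sum>q\<in>R. c q * int (card (invariants (marked_cosets G act p q)
          (\<lambda>n. \<lambda>C\<in>marked_cosets G act p q. n <# C) n)))" if "n \<in> ?N" for n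
        unfolding f_def c[OF rep_R[OF p that]]
        using mark_rep_gamma_pair[OF R RP[OF p] RP that] by (intro sum.cong) auto
      then have "f p \<one> * f p (g \<otimes> h) = (f p \<one> * f p g) * (f p \<one> * f p h)"
        if "g \<in> ?N" "h \<in> ?N" for g h
        using N.unit_virtual_permutation_character_mult[where Q = R and f = "f p" and c = c
            and E = "\<lambda>q. marked_cosets G act p q" and \<phi> = "\<lambda>q n. \<lambda>C\<in>marked_cosets G act p q. n <# C"]
          fin finite_reps[OF R] stab_action_on_marked_cosets[OF RP[OF p] RP]
          finite_marked_cosets[OF RP] f_unit[OF p] that by simp
      then show ?thesis unfolding hom[OF p] f_one[OF p] by blast
    qed
    then show "\<forall>(U, t)\<in>R. gamma G act L R x (U, t) \<in> hom (aut_group G act L (U, t)) sign_group"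
      by auto
  next
    assume all: "\<forall>(U, t)\<in>R. gamma G act L R x (U, t) \<in> hom (aut_group G act L (U, t)) sign_group"
    have "int (card (pair_stab G act L p)) dvd (\<Sum>n\<in>pair_stab G act L p. f p n)" if p: "p \<in> R" for p
    proof -
      let ?N = "pair_stab G act L p"
      have N: "subgroup ?N G" using subgroup_pair_stab[OF RP[OF p]] .
      have "gamma G act L R x p \<in> hom (aut_group G act L p) sign_group" using all p by auto
      then have mult: "x p * f p (g \<otimes> h) = (x p * f p g) * (x p * f p h)" if "g \<in> ?N" "h \<in> ?N" for g h
        using that unfolding hom[OF p] by blast
      have xx: "x p * x p = 1" using x(2)[OF p] by auto
      have "int (card ?N) dvd (\<Sum>n\<in>?N. x p * f p n)"
      proof (cases "\<exists>h\<in>?N. x p * f p h = - 1")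
        case True
        then obtain h where "h \<in> ?N" "x p * f p h = - 1" by blast
        then have "(\<Sum>n\<in>?N. x p * f p n) = 0"
          using sum_sign_character_eq_0[OF N, of "\<lambda>n. x p * f p n"] mult by blast
        then show ?thesis by simp
      next
        case False
        then have "x p * f p n = 1" if "n \<in> ?N" for n
          using f_unit[OF p that] x(2)[OF p] that by fastforce
        then show ?thesis by simp
      qed
      then have "int (card ?N) dvd x p * (\<Sum>n\<in>?N. x p * f p n)" by (rule dvd_mult)
      then show ?thesis by (simp add: sum_distrib_left[symmetric] mult.assoc[symmetric] xx)
    qed
    then have "stab_congruences R x" by (simp add: stab_congruences_def f_def)
    then show "x \<in> alpha_phi G act R ` carrier (lattice_burnside_ring G act L R)"
      using in_image_alpha_phi_iff[OF R x(1)] mark_combination_iff_congruences[OF R] by blast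
  qed
qed

end

lemma Units_ghost_ring:
  assumes "x \<in> Units (ghost_ring R)"
  shows "x \<in> R \<rightarrow>\<^sub>E UNIV" "p \<in> R \<Longrightarrow> x p \<in> {1, - 1}"
proof -
  obtain y where y: "(\<lambda>p\<in>R. x p * y p) = (\<lambda>p\<in>R. 1)" and x: "x \<in> R \<rightarrow>\<^sub>E UNIV"
    using assms by (auto simp: Units_def ghost_ring_def)
  show "x \<in> R \<rightarrow>\<^sub>E UNIV" using x .
  assume "p \<in> R"
  then have "x p * y p = 1" using fun_cong[OF y, of p] by simp
  then show "x p \<in> {1, - 1}" by (auto simp: zmult_eq_1_iff)
qed

theorem proposition5p7:
  fixes G :: "('g, 'm) monoid_scheme"
    and act :: "'g \<Rightarrow> 'l::{finite, lattice} \<Rightarrow> 'l"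
    and L :: "'g set \<Rightarrow> 'l set"
    and R :: "('g set \<times> 'l) set"
    and x :: "'g set \<times> 'l \<Rightarrow> int"
  assumes "admissible_family G act L"
    and "orbit_reps G act L R"
    and "x \<in> Units (ghost_ring R)"
  shows "x \<in> alpha_phi G act R ` carrier (lattice_burnside_ring G act L R) \<longleftrightarrow>
    (\<forall>(U, t)\<in>R. gamma G act L R x (U, t) \<in> hom (aut_group G act L (U, t)) sign_group)"
  using admissible_family.unit_in_image_iff[OF assms(1,2)] Units_ghost_ring[OF assms(3)] by blast

end
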